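(* Let $\mathbf{BM}_{\mathrm{gr}}\subset\mathbf{BM}$ denote the wide subcategory of the Borisov--Manin category of graphs with only graftings as morphisms, and let $\dot{\mathbf{Gr}}_{\mathrm{rc}}\subset\mathbf{Gr}$ denote the wide subcategory whose objects are the graphs without isolated edges, and whose morphisms are the reduced covers. There is a canonical equivalence $$\Phi_1:\mathbf{BM}_{\mathrm{gr}}\xrightarrow{\ \sim\ }\dot{\mathbf{Gr}}_{\mathrm{rc}}.$$
   Context: **The Borisov--Manin category $\mathbf{BM}$.** A BM graph is a quadruple $\tau=(V_\tau,F_\tau,\partial_\tau,j_\tau)$ with $V_\tau$ a set (of vertices), $F_\tau$ a set (of flags), $\partial_\tau:F_\tau\to V_\tau$ a map and $j_\tau:F_\tau\to F_\tau$ an involution. Fixed points of $j_\tau$ are called tails; two-element $j_\tau$-orbits are called edges. A morphism $h:\tau\to\sigma$ is a triple $(h^F,h_V,j_h)$ with $h^F:F_\sigma\to F_\tau$ a map, $h_V:V_\tau\to V_\sigma$ a map, and $j_h$ an involution on $F_\tau\setminus h^F(F_\sigma)$ such that: (i) $h^F$ is injective and $h_V$ is surjective; (ii) $h^F(F_\sigma)$ and its complement are $j_\tau$-invariant; (ii') $j_h$ is fixpoint free and agrees with $j_\tau$ on those flags of its domain that belong to edges of $\tau$; (iii) if $f_\tau=h^F(f_\sigma)$ then $h_V(\partial_\tau f_\tau)=\partial_\sigma f_\sigma$, and for every $f\in F_\tau\setminus h^F(F_\sigma)$ one has $h_V(\partial_\tau f)=h_V(\partial_\tau j_h(f))$; (iv)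 the bijection $(h^F)^{-1}:h^F(F_\sigma)\to F_\sigma$ maps edges of $\tau$ to edges of $\sigma$. The composite of $g:\tau\to\sigma$ and $c:\sigma\to\rho$ is $h=c\circ g$ with $h_V=c_V\circ g_V$, $h^F=g^F\circ c^F$, and $j_h$ equal to $j_g$ on $F_\tau\setminus g^F(F_\sigma)$ and to $j_c$ (transported along the injection $g^F$) on $g^F(F_\sigma\setminus c^F(F_\rho))$. A morphism $h$ is a grafting when both $h_V$ and $h^F$ are bijective. **The category $\mathbf{Gr}$ (Joyal--Kock graphs).** A graph in the sense of Joyal--Kock is a diagram of finite sets $A\xleftarrow{s}H\xrightarrow{p}V$ together with a fixpoint-free involution $i:A\to A$, with $s$ injective. $V$ is the set of vertices, $H$ the set of half-edges, $A$ the set of arcs. An edge is an $i$-orbit; it is isolated if neither of its arcs is in the image of $s$. An etale morphism of graphs is a triple of maps on $A,H,V$ commuting with $i,s,p$ and such that the square involving $p:H\to V$ is a pullback. $\mathbf{Gr}$ is the category of graphs and etale morphisms. A covering family of a graph $\mathsf X$ is a family of etale morphisms with codomain $\mathsf X$ that is jointly surjective on edges and vertices; it is reduced when no member can be omitted or replaced by a proper subgraph without spoiling the joint surjectivity. A reduced cover is the single etale morphism obtained from a reduced covering family by taking the sum (disjoint union) of the domains. In the absence of isolated edges, this means an etale morphism that is bijective on vertices.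
   Formalization: BM graphs are required to have finite sets of vertices and flags; with arbitrary sets the equivalence fails, since Joyal–Kock graphs are finite and have finite hom-sets. *)

theory Defs
  imports Main "HOL-Library.FuncSet"
begin

section \<open>Categories, functors, equivalences\<close>

text \<open>
  A category is given by its hom-sets, which need not be disjoint: a morphism is always considered
  together with its domain and codomain. Thus \<open>cmp C X Y Z g f\<close> is the composite
  \<open>g \<circ> f\<close> of \<open>f : X \<rightarrow> Y\<close> and \<open>g : Y \<rightarrow> Z\<close>, and the action of a functor on morphisms
  takes the domain and codomain as arguments.
\<close>

record ('o, 'm) cat =
  ob  :: "'o set"
  hom :: "'o \<Rightarrow> 'o \<Rightarrow> 'm set"
  idm :: "'o \<Rightarrow> 'm"
  cmp :: "'o \<Rightarrow> 'o \<Rightarrow> 'o \<Rightarrow> 'm \<Rightarrow> 'm \<Rightarrow> 'm"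

locale category =
  fixes C :: "('o, 'm) cat"
  assumes idm_hom: "X \<in> ob C \<Longrightarrow> idm C X \<in> hom C X X"
    and cmp_hom: "\<lbrakk>X \<in> ob C; Y \<in> ob C; Z \<in> ob C; f \<in> hom C X Y; g \<in> hom C Y Z\<rbrakk>
      \<Longrightarrow> cmp C X Y Z g f \<in> hom C X Z"
    and cmp_idm: "\<lbrakk>X \<in> ob C; Y \<in> ob C; f \<in> hom C X Y\<rbrakk> \<Longrightarrow> cmp C X X Y f (idm C X) = f"
    and idm_cmp: "\<lbrakk>X \<in> ob C; Y \<in> ob C; f \<in> hom C X Y\<rbrakk> \<Longrightarrow> cmp C X Y Y (idm C Y) f = f"
    and cmp_assoc: "\<lbrakk>W \<in> ob C; X \<in> ob C; Y \<in> ob C; Z \<in> ob C;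
        f \<in> hom C W X; g \<in> hom C X Y; h \<in> hom C Y Z\<rbrakk>
      \<Longrightarrow> cmp C W X Z (cmp C X Y Z h g) f = cmp C W Y Z h (cmp C W X Y g f)"

definition subcat :: "('o, 'm) cat \<Rightarrow> ('o \<Rightarrow> bool) \<Rightarrow> ('o \<Rightarrow> 'o \<Rightarrow> 'm \<Rightarrow> bool) \<Rightarrow> ('o, 'm) cat" where
  "subcat C P Q = C\<lparr>ob := {X \<in> ob C. P X}, hom := (\<lambda>X Y. {f \<in> hom C X Y. Q X Y f})\<rparr>"

definition iso_in :: "('o, 'm) cat \<Rightarrow> 'o \<Rightarrow> 'o \<Rightarrow> 'm \<Rightarrow> bool" where
  "iso_in C X Y f \<longleftrightarrow> f \<in> hom C X Y \<and>
     (\<exists>g \<in> hom C Y X. cmp C X Y X g f = idm C X \<and> cmp C Y X Y f g = idm C Y)"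

locale functor_between = C: category C + D: category D
  for C :: "('o, 'm) cat" and D :: "('p, 'n) cat" +
  fixes Fo :: "'o \<Rightarrow> 'p" and Fm :: "'o \<Rightarrow> 'o \<Rightarrow> 'm \<Rightarrow> 'n"
  assumes functor_ob: "X \<in> ob C \<Longrightarrow> Fo X \<in> ob D"
    and functor_hom: "\<lbrakk>X \<in> ob C; Y \<in> ob C; f \<in> hom C X Y\<rbrakk> \<Longrightarrow> Fm X Y f \<in> hom D (Fo X) (Fo Y)"
    and functor_idm: "X \<in> ob C \<Longrightarrow> Fm X X (idm C X) = idm D (Fo X)"
    and functor_cmp: "\<lbrakk>X \<in> ob C; Y \<in> ob C; Z \<in> ob C; f \<in> hom C X Y; g \<in> hom C Y Z\<rbrakk>
      \<Longrightarrow> Fm X Z (cmp C X Y Z g f) = cmp D (Fo X) (Fo Y) (Fo Z) (Fm Y Z g) (Fm X Y f)"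

definition natural_iso ::
  "('o, 'm) cat \<Rightarrow> ('p, 'n) cat \<Rightarrow> ('o \<Rightarrow> 'p) \<Rightarrow> ('o \<Rightarrow> 'o \<Rightarrow> 'm \<Rightarrow> 'n) \<Rightarrow>
   ('o \<Rightarrow> 'p) \<Rightarrow> ('o \<Rightarrow> 'o \<Rightarrow> 'm \<Rightarrow> 'n) \<Rightarrow> ('o \<Rightarrow> 'n) \<Rightarrow> bool" where
  "natural_iso C D Fo Fm Go Gm \<eta> \<longleftrightarrow>
     functor_between C D Fo Fm \<and> functor_between C D Go Gm \<and>
     (\<forall>X \<in> ob C. iso_in D (Fo X) (Go X) (\<eta> X)) \<and>
     (\<forall>X \<in> ob C. \<forall>Y \<in> ob C. \<forall>f \<in> hom C X Y.
        cmp D (Fo X) (Go X) (Go Y) (Gm X Y f) (\<eta> X) = cmp D (Fo X) (Fo Y) (Go Y) (\<eta> Y) (Fm X Y f))"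

definition equivalence_of_categories ::
  "('o, 'm) cat \<Rightarrow> ('p, 'n) cat \<Rightarrow> ('o \<Rightarrow> 'p) \<Rightarrow> ('o \<Rightarrow> 'o \<Rightarrow> 'm \<Rightarrow> 'n) \<Rightarrow> bool" where
  "equivalence_of_categories C D Fo Fm \<longleftrightarrow>
     functor_between C D Fo Fm \<and>
     (\<exists>Go Gm \<eta> \<epsilon>.
        functor_between D C Go Gm \<and>
        natural_iso C C (\<lambda>X. X) (\<lambda>X Y f. f) (\<lambda>X. Go (Fo X)) (\<lambda>X Y f. Gm (Fo X) (Fo Y) (Fm X Y f)) \<eta> \<and>
        natural_iso D D (\<lambda>X. Fo (Go X)) (\<lambda>X Y f. Fm (Go X) (Go Y) (Gm X Y f)) (\<lambda>X. X) (\<lambda>X Y f. f) \<epsilon>)"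


section \<open>The Borisov--Manin category\<close>

text \<open>
  Here and below, maps between carrier sets are required to be extensional (\<open>\<rightarrow>\<^sub>E\<close>), so that equality
  of graphs and of morphisms is equality of the underlying mathematical data. Graphs are finite. The
  flag map of a morphism of BM graphs is contravariant, and its last component is an involution of
  the flags outside the image of the flag map.
\<close>

record ('f, 'v) bm_graph =
  bm_verts :: "'v set"
  bm_flags :: "'f set"
  bm_bdry  :: "'f \<Rightarrow> 'v"
  bm_inv   :: "'f \<Rightarrow> 'f"

definition is_bm_graph :: "('f, 'v) bm_graph \<Rightarrow> bool" where
  "is_bm_graph \<tau> \<longleftrightarrow> finite (bm_verts \<tau>) \<and> finite (bm_flags \<tau>) \<and>
     bm_bdry \<tau> \<in> bm_flags \<tau> \<rightarrow>\<^sub>E bm_verts \<tau> \<and>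
     bm_inv \<tau> \<in> bm_flags \<tau> \<rightarrow>\<^sub>E bm_flags \<tau> \<and>
     (\<forall>f \<in> bm_flags \<tau>. bm_inv \<tau> (bm_inv \<tau> f) = f)"

definition bm_tails :: "('f, 'v) bm_graph \<Rightarrow> 'f set" where
  "bm_tails \<tau> = {f \<in> bm_flags \<tau>. bm_inv \<tau> f = f}"

definition bm_edges :: "('f, 'v) bm_graph \<Rightarrow> 'f set set" where
  "bm_edges \<tau> = {{f, bm_inv \<tau> f} | f. f \<in> bm_flags \<tau> \<and> bm_inv \<tau> f \<noteq> f}"

record ('f, 'v) bm_mor =
  bm_mor_flag :: "'f \<Rightarrow> 'f"
  bm_mor_vert :: "'v \<Rightarrow> 'v"
  bm_mor_inv  :: "'f \<Rightarrow> 'f"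

definition bm_lost_flags :: "('f, 'v) bm_graph \<Rightarrow> ('f, 'v) bm_graph \<Rightarrow> ('f, 'v) bm_mor \<Rightarrow> 'f set" where
  "bm_lost_flags \<tau> \<sigma> h = bm_flags \<tau> - bm_mor_flag h ` bm_flags \<sigma>"

definition bm_hom :: "('f, 'v) bm_graph \<Rightarrow> ('f, 'v) bm_graph \<Rightarrow> ('f, 'v) bm_mor set" where
  "bm_hom \<tau> \<sigma> = {h.
     bm_mor_flag h \<in> bm_flags \<sigma> \<rightarrow>\<^sub>E bm_flags \<tau> \<and>
     bm_mor_vert h \<in> bm_verts \<tau> \<rightarrow>\<^sub>E bm_verts \<sigma> \<and>
     bm_mor_inv h \<in> bm_lost_flags \<tau> \<sigma> h \<rightarrow>\<^sub>E bm_lost_flags \<tau> \<sigma> h \<and>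
     (\<forall>f \<in> bm_lost_flags \<tau> \<sigma> h. bm_mor_inv h (bm_mor_inv h f) = f) \<and>
     inj_on (bm_mor_flag h) (bm_flags \<sigma>) \<and>
     bm_mor_vert h ` bm_verts \<tau> = bm_verts \<sigma> \<and>
     bm_inv \<tau> ` (bm_mor_flag h ` bm_flags \<sigma>) \<subseteq> bm_mor_flag h ` bm_flags \<sigma> \<and>
     bm_inv \<tau> ` bm_lost_flags \<tau> \<sigma> h \<subseteq> bm_lost_flags \<tau> \<sigma> h \<and>
     (\<forall>f \<in> bm_lost_flags \<tau> \<sigma> h. bm_mor_inv h f \<noteq> f) \<and>
     (\<forall>f \<in> bm_lost_flags \<tau> \<sigma> h. f \<in> \<Union> (bm_edges \<tau>) \<longrightarrow> bm_mor_inv h f = bm_inv \<tau> f) \<and>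
     (\<forall>f \<in> bm_flags \<sigma>. bm_mor_vert h (bm_bdry \<tau> (bm_mor_flag h f)) = bm_bdry \<sigma> f) \<and>
     (\<forall>f \<in> bm_lost_flags \<tau> \<sigma> h.
        bm_mor_vert h (bm_bdry \<tau> f) = bm_mor_vert h (bm_bdry \<tau> (bm_mor_inv h f))) \<and>
     (\<forall>e \<in> bm_edges \<tau>. e \<subseteq> bm_mor_flag h ` bm_flags \<sigma> \<longrightarrow>
        inv_into (bm_flags \<sigma>) (bm_mor_flag h) ` e \<in> bm_edges \<sigma>)}"

definition bm_id :: "('f, 'v) bm_graph \<Rightarrow> ('f, 'v) bm_mor" where
  "bm_id \<tau> = \<lparr>bm_mor_flag = (\<lambda>f \<in> bm_flags \<tau>. f), bm_mor_vert = (\<lambda>v \<in> bm_verts \<tau>. v),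
              bm_mor_inv = (\<lambda>_. undefined)\<rparr>"

definition bm_comp ::
  "('f, 'v) bm_graph \<Rightarrow> ('f, 'v) bm_graph \<Rightarrow> ('f, 'v) bm_graph \<Rightarrow>
   ('f, 'v) bm_mor \<Rightarrow> ('f, 'v) bm_mor \<Rightarrow> ('f, 'v) bm_mor" where
  "bm_comp \<tau> \<sigma> \<rho> c g =
     \<lparr>bm_mor_flag = compose (bm_flags \<rho>) (bm_mor_flag g) (bm_mor_flag c),
      bm_mor_vert = compose (bm_verts \<tau>) (bm_mor_vert c) (bm_mor_vert g),
      bm_mor_inv = (\<lambda>f \<in> bm_flags \<tau> - bm_mor_flag g ` bm_mor_flag c ` bm_flags \<rho>.
        if f \<in> bm_lost_flags \<tau> \<sigma> g then bm_mor_inv g f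
        else bm_mor_flag g (bm_mor_inv c (inv_into (bm_flags \<sigma>) (bm_mor_flag g) f)))\<rparr>"

definition BM :: "(('f, 'v) bm_graph, ('f, 'v) bm_mor) cat" where
  "BM = \<lparr>ob = {\<tau>. is_bm_graph \<tau>}, hom = bm_hom, idm = bm_id, cmp = bm_comp\<rparr>"

definition is_grafting :: "('f, 'v) bm_graph \<Rightarrow> ('f, 'v) bm_graph \<Rightarrow> ('f, 'v) bm_mor \<Rightarrow> bool" where
  "is_grafting \<tau> \<sigma> h \<longleftrightarrow>
     bij_betw (bm_mor_vert h) (bm_verts \<tau>) (bm_verts \<sigma>) \<and>
     bij_betw (bm_mor_flag h) (bm_flags \<sigma>) (bm_flags \<tau>)"

definition BM_gr :: "(('f, 'v) bm_graph, ('f, 'v) bm_mor) cat" where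
  "BM_gr = subcat BM (\<lambda>\<tau>. True) is_grafting"


section \<open>Joyal--Kock graphs and etale morphisms\<close>

record ('a, 'h, 'v) jk_graph =
  jk_arcs  :: "'a set"
  jk_half  :: "'h set"
  jk_verts :: "'v set"
  jk_s :: "'h \<Rightarrow> 'a"
  jk_p :: "'h \<Rightarrow> 'v"
  jk_i :: "'a \<Rightarrow> 'a"

definition is_jk_graph :: "('a, 'h, 'v) jk_graph \<Rightarrow> bool" where
  "is_jk_graph X \<longleftrightarrow> finite (jk_arcs X) \<and> finite (jk_half X) \<and> finite (jk_verts X) \<and>
     jk_s X \<in> jk_half X \<rightarrow>\<^sub>E jk_arcs X \<and> inj_on (jk_s X) (jk_half X) \<and>
     jk_p X \<in> jk_half X \<rightarrow>\<^sub>E jk_verts X \<and>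
     jk_i X \<in> jk_arcs X \<rightarrow>\<^sub>E jk_arcs X \<and>
     (\<forall>a \<in> jk_arcs X. jk_i X (jk_i X a) = a \<and> jk_i X a \<noteq> a)"

definition jk_edges :: "('a, 'h, 'v) jk_graph \<Rightarrow> 'a set set" where
  "jk_edges X = {{a, jk_i X a} | a. a \<in> jk_arcs X}"

definition isolated_edge :: "('a, 'h, 'v) jk_graph \<Rightarrow> 'a set \<Rightarrow> bool" where
  "isolated_edge X e \<longleftrightarrow> e \<in> jk_edges X \<and> e \<inter> jk_s X ` jk_half X = {}"

record ('a, 'h, 'v) jk_mor =
  jk_mor_arc  :: "'a \<Rightarrow> 'a"
  jk_mor_half :: "'h \<Rightarrow> 'h"
  jk_mor_vert :: "'v \<Rightarrow> 'v"

text \<open>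
  The last condition says that the square formed by \<open>p\<close> and the maps on half-edges and vertices is
  a pullback: the comparison map into the fibre product is bijective.
\<close>

definition etale_hom :: "('a, 'h, 'v) jk_graph \<Rightarrow> ('a, 'h, 'v) jk_graph \<Rightarrow> ('a, 'h, 'v) jk_mor set" where
  "etale_hom X Y = {f.
     jk_mor_arc f \<in> jk_arcs X \<rightarrow>\<^sub>E jk_arcs Y \<and>
     jk_mor_half f \<in> jk_half X \<rightarrow>\<^sub>E jk_half Y \<and>
     jk_mor_vert f \<in> jk_verts X \<rightarrow>\<^sub>E jk_verts Y \<and>
     (\<forall>a \<in> jk_arcs X. jk_mor_arc f (jk_i X a) = jk_i Y (jk_mor_arc f a)) \<and>
     (\<forall>h \<in> jk_half X. jk_mor_arc f (jk_s X h) = jk_s Y (jk_mor_half f h)) \<and>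
     (\<forall>h \<in> jk_half X. jk_mor_vert f (jk_p X h) = jk_p Y (jk_mor_half f h)) \<and>
     bij_betw (\<lambda>h. (jk_p X h, jk_mor_half f h)) (jk_half X)
       {(v, k) \<in> jk_verts X \<times> jk_half Y. jk_mor_vert f v = jk_p Y k}}"

definition jk_id :: "('a, 'h, 'v) jk_graph \<Rightarrow> ('a, 'h, 'v) jk_mor" where
  "jk_id X = \<lparr>jk_mor_arc = (\<lambda>a \<in> jk_arcs X. a), jk_mor_half = (\<lambda>h \<in> jk_half X. h),
              jk_mor_vert = (\<lambda>v \<in> jk_verts X. v)\<rparr>"

definition jk_comp ::
  "('a, 'h, 'v) jk_graph \<Rightarrow> ('a, 'h, 'v) jk_graph \<Rightarrow> ('a, 'h, 'v) jk_graph \<Rightarrow>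
   ('a, 'h, 'v) jk_mor \<Rightarrow> ('a, 'h, 'v) jk_mor \<Rightarrow> ('a, 'h, 'v) jk_mor" where
  "jk_comp X Y Z g f =
     \<lparr>jk_mor_arc = compose (jk_arcs X) (jk_mor_arc g) (jk_mor_arc f),
      jk_mor_half = compose (jk_half X) (jk_mor_half g) (jk_mor_half f),
      jk_mor_vert = compose (jk_verts X) (jk_mor_vert g) (jk_mor_vert f)\<rparr>"

definition Gr :: "(('a, 'h, 'v) jk_graph, ('a, 'h, 'v) jk_mor) cat" where
  "Gr = \<lparr>ob = {X. is_jk_graph X}, hom = etale_hom, idm = jk_id, cmp = jk_comp\<rparr>"


section \<open>Reduced covers\<close>

text \<open>
  Subgraphs are those whose inclusion is etale, since replacing a member of a covering family by a
  subgraph has to yield a family of etale morphisms again.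
\<close>

definition subgraph :: "('a, 'h, 'v) jk_graph \<Rightarrow> ('a, 'h, 'v) jk_graph \<Rightarrow> bool" where
  "subgraph Z Y \<longleftrightarrow> is_jk_graph Z \<and> jk_id Z \<in> etale_hom Z Y"

definition covering_family ::
  "('a, 'h, 'v) jk_graph \<Rightarrow> 'k set \<Rightarrow> ('k \<Rightarrow> ('a, 'h, 'v) jk_graph) \<Rightarrow> ('k \<Rightarrow> ('a, 'h, 'v) jk_mor) \<Rightarrow> bool" where
  "covering_family X K D f \<longleftrightarrow>
     (\<forall>k \<in> K. is_jk_graph (D k) \<and> f k \<in> etale_hom (D k) X) \<and>
     (\<Union>k \<in> K. (\<lambda>e. jk_mor_arc (f k) ` e) ` jk_edges (D k)) = jk_edges X \<and>
     (\<Union>k \<in> K. jk_mor_vert (f k) ` jk_verts (D k)) = jk_verts X"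

definition reduced_covering_family ::
  "('a, 'h, 'v) jk_graph \<Rightarrow> 'k set \<Rightarrow> ('k \<Rightarrow> ('a, 'h, 'v) jk_graph) \<Rightarrow> ('k \<Rightarrow> ('a, 'h, 'v) jk_mor) \<Rightarrow> bool" where
  "reduced_covering_family X K D f \<longleftrightarrow>
     covering_family X K D f \<and>
     (\<forall>k \<in> K. \<not> covering_family X (K - {k}) D f) \<and>
     (\<forall>k \<in> K. \<forall>Z. subgraph Z (D k) \<and> Z \<noteq> D k \<longrightarrow>
        \<not> covering_family X K (D(k := Z)) (f(k := jk_comp Z (D k) X (f k) (jk_id Z))))"

definition is_sum ::
  "'k set \<Rightarrow> ('k \<Rightarrow> ('a, 'h, 'v) jk_graph) \<Rightarrow> ('k \<Rightarrow> ('a, 'h, 'v) jk_mor) \<Rightarrow> ('a, 'h, 'v) jk_graph \<Rightarrow> bool" where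
  "is_sum K D \<iota> Y \<longleftrightarrow> is_jk_graph Y \<and>
     (\<forall>k \<in> K. is_jk_graph (D k) \<and> \<iota> k \<in> etale_hom (D k) Y) \<and>
     bij_betw (\<lambda>(k, a). jk_mor_arc (\<iota> k) a) (SIGMA k:K. jk_arcs (D k)) (jk_arcs Y) \<and>
     bij_betw (\<lambda>(k, h). jk_mor_half (\<iota> k) h) (SIGMA k:K. jk_half (D k)) (jk_half Y) \<and>
     bij_betw (\<lambda>(k, v). jk_mor_vert (\<iota> k) v) (SIGMA k:K. jk_verts (D k)) (jk_verts Y)"

text \<open>
  Natural numbers suffice as indices: each member of a reduced covering family is needed to hit some
  edge or vertex of the finite graph \<open>X\<close>, so the family is finite. The index set may be empty.
\<close>

definition reduced_cover ::
  "('a, 'h, 'v) jk_graph \<Rightarrow> ('a, 'h, 'v) jk_graph \<Rightarrow> ('a, 'h, 'v) jk_mor \<Rightarrow> bool" where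
  "reduced_cover Y X f \<longleftrightarrow> f \<in> etale_hom Y X \<and>
     (\<exists>(K :: nat set) D fam \<iota>. reduced_covering_family X K D fam \<and> is_sum K D \<iota> Y \<and>
        (\<forall>k \<in> K. jk_comp (D k) Y X f (\<iota> k) = fam k))"

definition Gr_rc :: "(('a, 'h, 'v) jk_graph, ('a, 'h, 'v) jk_mor) cat" where
  "Gr_rc = subcat Gr (\<lambda>X. \<nexists>e. isolated_edge X e) reduced_cover"


section \<open>The comparison functor\<close>

text \<open>
  Vertices and half-edges are the vertices and flags of the BM graph. Each flag \<open>f\<close> gives an arc
  \<open>Inl f\<close>, and each tail \<open>f\<close> gives a further arc \<open>Inr f\<close>, the opposite of \<open>Inl f\<close>. On morphisms the
  contravariant flag bijection of a grafting is inverted; the value on \<open>Inr f\<close> is then forced by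
  compatibility with the involutions.
\<close>

definition Phi1_ob :: "('f, 'v) bm_graph \<Rightarrow> ('f + 'f, 'f, 'v) jk_graph" where
  "Phi1_ob \<tau> =
     \<lparr>jk_arcs = bm_flags \<tau> <+> bm_tails \<tau>,
      jk_half = bm_flags \<tau>,
      jk_verts = bm_verts \<tau>,
      jk_s = (\<lambda>f \<in> bm_flags \<tau>. Inl f),
      jk_p = bm_bdry \<tau>,
      jk_i = (\<lambda>a \<in> bm_flags \<tau> <+> bm_tails \<tau>.
        case a of Inl f \<Rightarrow> if f \<in> bm_tails \<tau> then Inr f else Inl (bm_inv \<tau> f) | Inr f \<Rightarrow> Inl f)\<rparr>"

definition Phi1_mor ::
  "('f, 'v) bm_graph \<Rightarrow> ('f, 'v) bm_graph \<Rightarrow> ('f, 'v) bm_mor \<Rightarrow> ('f + 'f, 'f, 'v) jk_mor" where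
  "Phi1_mor \<tau> \<sigma> h =
     (let g = inv_into (bm_flags \<sigma>) (bm_mor_flag h) in
     \<lparr>jk_mor_arc = (\<lambda>a \<in> bm_flags \<tau> <+> bm_tails \<tau>.
        case a of Inl f \<Rightarrow> Inl (g f) | Inr f \<Rightarrow> jk_i (Phi1_ob \<sigma>) (Inl (g f))),
      jk_mor_half = (\<lambda>f \<in> bm_flags \<tau>. g f),
      jk_mor_vert = bm_mor_vert h\<rparr>)"

end

theory Submission
  imports Defs
begin

text \<open>
  The functor \<open>\<Phi>\<^sub>1\<close> is fully faithful and essentially surjective. Deleting a vertex and its
  half-edges, but no arcs, leaves an etale subgraph with the same edges. Hence a reduced cover is
  injective on vertices, as otherwise one of two vertices with the same image could be deleted.
  Conversely, if there are no isolated edges, everything is determined by what happens at the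
  vertices: an etale vertex bijection is bijective on half-edges by the pullback condition, and
  half-edges and their opposites exhaust the arcs. So reduced covers are the pairs of bijections on
  half-edges and on vertices that send two half-edges forming an edge to two half-edges forming an
  edge. Up to inverting the flag map, these are the graftings. Every graph without isolated edges is
  recovered up to isomorphism from its half-edges and vertices, an arc outside the image of \<open>s\<close> being
  the opposite of a half-edge that becomes a tail.
\<close>

section \<open>Fully faithful and essentially surjective functors\<close>

lemma functor_between_id: "category C \<Longrightarrow> functor_between C C (\<lambda>X. X) (\<lambda>X Y f. f)"
  by (simp add: functor_between_def functor_between_axioms_def)

lemma functor_between_comp:
  assumes "functor_between C D Fo Fm" "functor_between D E Go Gm"
  shows "functor_between C E (\<lambda>X. Go (Fo X)) (\<lambda>X Y f. Gm (Fo X) (Fo Y) (Fm X Y f))"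
proof -
  interpret F: functor_between C D Fo Fm by fact
  interpret G: functor_between D E Go Gm by fact
  show ?thesis
    by unfold_locales
       (simp_all add: F.functor_ob F.functor_hom F.functor_idm F.functor_cmp
          G.functor_ob G.functor_hom G.functor_idm G.functor_cmp)
qed

locale fully_faithful_functor = functor_between +
  assumes bij_betw_hom:
    "\<lbrakk>X \<in> ob C; Y \<in> ob C\<rbrakk> \<Longrightarrow> bij_betw (Fm X Y) (hom C X Y) (hom D (Fo X) (Fo Y))"

lemma (in category) bij_betw_cmp_iso:
  assumes "X \<in> ob C" "Y \<in> ob C" "Z \<in> ob C" and iso: "iso_in C Y Z e"
  shows "bij_betw (cmp C X Y Z e) (hom C X Y) (hom C X Z)"
proof -
  obtain e' where e: "e \<in> hom C Y Z" and e': "e' \<in> hom C Z Y"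
    and inv: "cmp C Y Z Y e' e = idm C Y" "cmp C Z Y Z e e' = idm C Z"
    using iso by (auto simp: iso_in_def)
  show ?thesis
  proof (rule bij_betw_byWitness[where f' = "cmp C X Z Y e'"])
    show "\<forall>f \<in> hom C X Y. cmp C X Z Y e' (cmp C X Y Z e f) = f"
      using assms e e' by (simp add: cmp_assoc[symmetric] inv idm_cmp)
    show "\<forall>g \<in> hom C X Z. cmp C X Y Z e (cmp C X Z Y e' g) = g"
      using assms e e' by (simp add: cmp_assoc[symmetric] inv idm_cmp)
  qed (use assms e e' in \<open>auto intro: cmp_hom\<close>)
qed

text \<open>
  The quasi-inverse is built as a right adjoint: morphisms \<open>X \<rightarrow> Go Y\<close> correspond to morphisms
  \<open>Fo X \<rightarrow> Y\<close>, and every equation between morphisms into \<open>Go Y\<close> is checked on the other side of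
  this bijection.
\<close>

locale fully_faithful_split_essentially_surjective = fully_faithful_functor +
  fixes Go :: "'c \<Rightarrow> 'a" and \<epsilon> :: "'c \<Rightarrow> 'd"
  assumes Go_ob: "Y \<in> ob D \<Longrightarrow> Go Y \<in> ob C"
    and iso_counit: "Y \<in> ob D \<Longrightarrow> iso_in D (Fo (Go Y)) Y (\<epsilon> Y)"
begin

definition untranspose :: "'a \<Rightarrow> 'c \<Rightarrow> 'b \<Rightarrow> 'd" where
  "untranspose X Y f = cmp D (Fo X) (Fo (Go Y)) Y (\<epsilon> Y) (Fm X (Go Y) f)"

definition transpose :: "'a \<Rightarrow> 'c \<Rightarrow> 'd \<Rightarrow> 'b" where
  "transpose X Y = inv_into (hom C X (Go Y)) (untranspose X Y)"

definition Gm :: "'c \<Rightarrow> 'c \<Rightarrow> 'd \<Rightarrow> 'b" where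
  "Gm Y Z g = transpose (Go Y) Z (cmp D (Fo (Go Y)) Y Z g (\<epsilon> Y))"

definition unit :: "'a \<Rightarrow> 'b" where
  "unit X = transpose X (Fo X) (idm D (Fo X))"

lemma counit_hom: "Y \<in> ob D \<Longrightarrow> \<epsilon> Y \<in> hom D (Fo (Go Y)) Y"
  using iso_counit by (simp add: iso_in_def)

lemma bij_betw_untranspose:
  assumes "X \<in> ob C" "Y \<in> ob D"
  shows "bij_betw (untranspose X Y) (hom C X (Go Y)) (hom D (Fo X) Y)"
proof -
  have "bij_betw (cmp D (Fo X) (Fo (Go Y)) Y (\<epsilon> Y) \<circ> Fm X (Go Y)) (hom C X (Go Y)) (hom D (Fo X) Y)"
    using assms
    by (intro bij_betw_trans[OF bij_betw_hom D.bij_betw_cmp_iso])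
       (simp_all add: Go_ob functor_ob iso_counit)
  then show ?thesis by (simp add: untranspose_def[abs_def] o_def)
qed

lemmas untranspose_inject =
  bij_betw_untranspose[THEN bij_betw_imp_inj_on, THEN inj_onD]

lemma transpose_hom:
  "\<lbrakk>X \<in> ob C; Y \<in> ob D; u \<in> hom D (Fo X) Y\<rbrakk> \<Longrightarrow> transpose X Y u \<in> hom C X (Go Y)"
  unfolding transpose_def by (metis bij_betw_untranspose bij_betw_imp_surj_on inv_into_into)

lemma untranspose_transpose:
  "\<lbrakk>X \<in> ob C; Y \<in> ob D; u \<in> hom D (Fo X) Y\<rbrakk> \<Longrightarrow> untranspose X Y (transpose X Y u) = u"
  unfolding transpose_def by (metis bij_betw_untranspose bij_betw_inv_into_right)

lemma untranspose_cmp: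
  assumes "W \<in> ob C" "X \<in> ob C" "Y \<in> ob D" "f \<in> hom C W X" "g \<in> hom C X (Go Y)"
  shows "untranspose W Y (cmp C W X (Go Y) g f) = cmp D (Fo W) (Fo X) Y (untranspose X Y g) (Fm W X f)"
  using assms
  by (simp add: untranspose_def functor_cmp Go_ob D.cmp_assoc functor_ob functor_hom counit_hom)

lemma untranspose_idm: "Y \<in> ob D \<Longrightarrow> untranspose (Go Y) Y (idm C (Go Y)) = \<epsilon> Y"
  by (simp add: untranspose_def functor_idm Go_ob functor_ob counit_hom D.cmp_idm)

lemma Gm_hom:
  "\<lbrakk>Y \<in> ob D; Z \<in> ob D; g \<in> hom D Y Z\<rbrakk> \<Longrightarrow> Gm Y Z g \<in> hom C (Go Y) (Go Z)"
  unfolding Gm_def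
  by (intro transpose_hom D.cmp_hom[where Y = Y]) (simp_all add: Go_ob functor_ob counit_hom)

lemma untranspose_Gm:
  "\<lbrakk>Y \<in> ob D; Z \<in> ob D; g \<in> hom D Y Z\<rbrakk>
    \<Longrightarrow> untranspose (Go Y) Z (Gm Y Z g) = cmp D (Fo (Go Y)) Y Z g (\<epsilon> Y)"
  unfolding Gm_def
  by (intro untranspose_transpose D.cmp_hom[where Y = Y]) (simp_all add: Go_ob functor_ob counit_hom)

lemma untranspose_cmp_Gm:
  assumes "X \<in> ob C" "Y \<in> ob D" "Z \<in> ob D" "f \<in> hom C X (Go Y)" "g \<in> hom D Y Z"
  shows "untranspose X Z (cmp C X (Go Y) (Go Z) (Gm Y Z g) f) = cmp D (Fo X) Y Z g (untranspose X Y f)"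
  using assms
  by (simp add: untranspose_cmp Go_ob Gm_hom untranspose_Gm)
     (simp add: untranspose_def D.cmp_assoc Go_ob functor_ob functor_hom counit_hom)

lemma functor_Gm: "functor_between D C Go Gm"
proof
  show "Gm Y Y (idm D Y) = idm C (Go Y)" if Y: "Y \<in> ob D" for Y
    by (rule untranspose_inject[OF Go_ob[OF Y] Y])
       (use Y in \<open>simp_all add: untranspose_Gm untranspose_idm Gm_hom D.idm_hom C.idm_hom D.idm_cmp
          Go_ob functor_ob counit_hom\<close>)
  show "Gm X Z (cmp D X Y Z g f) = cmp C (Go X) (Go Y) (Go Z) (Gm Y Z g) (Gm X Y f)"
    if "X \<in> ob D" "Y \<in> ob D" "Z \<in> ob D" "f \<in> hom D X Y" "g \<in> hom D Y Z" for X Y Z f g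
  proof (rule untranspose_inject)
    show "untranspose (Go X) Z (Gm X Z (cmp D X Y Z g f))
        = untranspose (Go X) Z (cmp C (Go X) (Go Y) (Go Z) (Gm Y Z g) (Gm X Y f))"
      using that
      by (simp add: untranspose_cmp_Gm untranspose_Gm Gm_hom D.cmp_hom D.cmp_assoc
          Go_ob functor_ob counit_hom)
  qed (use that in \<open>simp_all add: Go_ob Gm_hom D.cmp_hom C.cmp_hom\<close>)
qed (simp_all add: Go_ob Gm_hom)

lemma unit_hom: "X \<in> ob C \<Longrightarrow> unit X \<in> hom C X (Go (Fo X))"
  by (simp add: unit_def transpose_hom functor_ob D.idm_hom)

lemma untranspose_unit: "X \<in> ob C \<Longrightarrow> untranspose X (Fo X) (unit X) = idm D (Fo X)"
  by (simp add: unit_def untranspose_transpose functor_ob D.idm_hom)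

lemma iso_unit:
  assumes X: "X \<in> ob C"
  shows "iso_in C X (Go (Fo X)) (unit X)"
proof -
  note GFX = Go_ob[OF functor_ob[OF X]]
  obtain \<theta> where \<theta>: "\<theta> \<in> hom C (Go (Fo X)) X" "Fm (Go (Fo X)) X \<theta> = \<epsilon> (Fo X)"
    using bij_betw_hom[OF GFX X] counit_hom[OF functor_ob[OF X]]
    by (metis bij_betw_imp_surj_on imageE)
  have "cmp C X (Go (Fo X)) X \<theta> (unit X) = idm C X"
  proof (rule bij_betw_hom[OF X X, THEN bij_betw_imp_inj_on, THEN inj_onD])
    show "Fm X X (cmp C X (Go (Fo X)) X \<theta> (unit X)) = Fm X X (idm C X)"
      using X \<theta> untranspose_unit[OF X]
      by (simp add: functor_cmp functor_idm GFX unit_hom untranspose_def)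
  qed (use X \<theta> in \<open>simp_all add: C.cmp_hom C.idm_hom GFX unit_hom\<close>)
  moreover have "cmp C (Go (Fo X)) X (Go (Fo X)) (unit X) \<theta> = idm C (Go (Fo X))"
    by (rule untranspose_inject[OF GFX functor_ob[OF X]])
       (use X \<theta> in \<open>simp_all add: untranspose_cmp untranspose_unit untranspose_idm functor_ob GFX
          unit_hom C.cmp_hom C.idm_hom D.idm_cmp counit_hom\<close>)
  ultimately show ?thesis using \<theta> unit_hom[OF X] by (auto simp: iso_in_def)
qed

lemma unit_natural:
  assumes "X \<in> ob C" "Y \<in> ob C" "f \<in> hom C X Y"
  shows "cmp C X (Go (Fo X)) (Go (Fo Y)) (Gm (Fo X) (Fo Y) (Fm X Y f)) (unit X)
    = cmp C X Y (Go (Fo Y)) (unit Y) f"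
proof (rule untranspose_inject)
  have "untranspose X (Fo Y) (cmp C X (Go (Fo X)) (Go (Fo Y)) (Gm (Fo X) (Fo Y) (Fm X Y f)) (unit X))
      = Fm X Y f"
    using assms
    by (simp add: untranspose_cmp_Gm untranspose_unit functor_ob functor_hom unit_hom D.cmp_idm)
  also have "\<dots> = untranspose X (Fo Y) (cmp C X Y (Go (Fo Y)) (unit Y) f)"
    using assms by (simp add: untranspose_cmp untranspose_unit functor_ob functor_hom unit_hom D.idm_cmp)
  finally show "untranspose X (Fo Y)
      (cmp C X (Go (Fo X)) (Go (Fo Y)) (Gm (Fo X) (Fo Y) (Fm X Y f)) (unit X))
    = untranspose X (Fo Y) (cmp C X Y (Go (Fo Y)) (unit Y) f)" .
qed (use assms in \<open>simp_all add: functor_ob functor_hom Gm_hom unit_hom Go_ob C.cmp_hom\<close>)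

lemma counit_natural:
  "\<lbrakk>Y \<in> ob D; Z \<in> ob D; g \<in> hom D Y Z\<rbrakk> \<Longrightarrow> cmp D (Fo (Go Y)) Y Z g (\<epsilon> Y)
    = cmp D (Fo (Go Y)) (Fo (Go Z)) Z (\<epsilon> Z) (Fm (Go Y) (Go Z) (Gm Y Z g))"
  using untranspose_Gm by (simp add: untranspose_def)

theorem equivalence: "equivalence_of_categories C D Fo Fm"
proof -
  note F = functor_between_axioms and G = functor_Gm
  have "natural_iso C C (\<lambda>X. X) (\<lambda>X Y f. f) (\<lambda>X. Go (Fo X))
      (\<lambda>X Y f. Gm (Fo X) (Fo Y) (Fm X Y f)) unit"
    using functor_between_id[OF C.category_axioms] functor_between_comp[OF F G]
    by (auto simp: natural_iso_def iso_unit unit_natural)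
  moreover have "natural_iso D D (\<lambda>Y. Fo (Go Y)) (\<lambda>Y Z g. Fm (Go Y) (Go Z) (Gm Y Z g))
      (\<lambda>Y. Y) (\<lambda>Y Z g. g) \<epsilon>"
    using functor_between_id[OF D.category_axioms] functor_between_comp[OF G F]
    by (auto simp: natural_iso_def iso_counit counit_natural)
  ultimately show ?thesis
    unfolding equivalence_of_categories_def using F G by blast
qed

end

theorem fully_faithful_essentially_surjective_equivalence:
  assumes "fully_faithful_functor C D Fo Fm"
    and "\<And>Y. Y \<in> ob D \<Longrightarrow> \<exists>X \<in> ob C. \<exists>e. iso_in D (Fo X) Y e"
  shows "equivalence_of_categories C D Fo Fm"
proof -
  obtain Go \<epsilon> where "\<And>Y. Y \<in> ob D \<Longrightarrow> Go Y \<in> ob C \<and> iso_in D (Fo (Go Y)) Y (\<epsilon> Y)"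
    using assms(2) by metis
  then have "fully_faithful_split_essentially_surjective C D Fo Fm Go \<epsilon>"
    using assms(1)
    by (simp add: fully_faithful_split_essentially_surjective_def
        fully_faithful_split_essentially_surjective_axioms_def)
  then show ?thesis by (rule fully_faithful_split_essentially_surjective.equivalence)
qed

lemma category_subcat:
  assumes "category C"
    and idm: "\<And>X. \<lbrakk>X \<in> ob C; P X\<rbrakk> \<Longrightarrow> Q X X (idm C X)"
    and cmp: "\<And>X Y Z f g. \<lbrakk>X \<in> ob C; P X; Y \<in> ob C; P Y; Z \<in> ob C; P Z;
        f \<in> hom C X Y; Q X Y f; g \<in> hom C Y Z; Q Y Z g\<rbrakk> \<Longrightarrow> Q X Z (cmp C X Y Z g f)"
  shows "category (subcat C P Q)"
proof -
  interpret category C by fact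
  show ?thesis
    by unfold_locales (auto simp: subcat_def idm_hom cmp_hom cmp_idm idm_cmp cmp_assoc idm cmp)
qed

section \<open>Etale morphisms\<close>

lemma bij_betw_pullback_iff_fibres:
  assumes "p \<in> A \<rightarrow> B" and "\<And>a. a \<in> A \<Longrightarrow> g (p a) = q (f a)"
  shows "bij_betw (\<lambda>a. (p a, f a)) A {(b, a') \<in> B \<times> A'. g b = q a'} \<longleftrightarrow>
    (\<forall>b \<in> B. bij_betw f {a \<in> A. p a = b} {a' \<in> A'. q a' = g b})"
    (is "bij_betw ?c A ?P \<longleftrightarrow> ?R")
proof
  assume bij: "bij_betw ?c A ?P"
  then have "f ` {a \<in> A. p a = b} = {a' \<in> A'. q a' = g b}" if "b \<in> B" for b
    using that unfolding bij_betw_def by (auto simp: set_eq_iff image_iff) metis+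
  then show ?R
    using bij by (auto simp: bij_betw_def inj_on_def)
next
  assume fibres: ?R
  then have "?c ` A = ?P"
    using assms unfolding bij_betw_def by (auto simp: set_eq_iff image_iff Pi_iff) metis+
  moreover have "inj_on ?c A"
    using fibres assms(1) unfolding bij_betw_def inj_on_def by (auto simp: Pi_iff)
  ultimately show "bij_betw ?c A ?P" by (simp add: bij_betw_def)
qed

lemma bij_betw_iff_fibres:
  assumes p: "p \<in> A \<rightarrow> B" and q: "q \<in> A' \<rightarrow> B'" and f: "f \<in> A \<rightarrow> A'"
    and g: "bij_betw g B B'" and square: "\<And>a. a \<in> A \<Longrightarrow> g (p a) = q (f a)"
  shows "bij_betw f A A' \<longleftrightarrow> (\<forall>b \<in> B. bij_betw f {a \<in> A. p a = b} {a' \<in> A'. q a' = g b})"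
proof -
  let ?P = "{(b, a') \<in> B \<times> A'. g b = q a'}"
  have "bij_betw snd ?P A'"
    using g q unfolding bij_betw_def inj_on_def by (auto simp: image_iff Pi_iff) metis+
  moreover have "(\<lambda>a. (p a, f a)) ` A \<subseteq> ?P"
    using p f square by auto
  ultimately have "bij_betw (\<lambda>a. (p a, f a)) A ?P \<longleftrightarrow> bij_betw (snd \<circ> (\<lambda>a. (p a, f a))) A A'"
    by (rule bij_betw_comp_iff2)
  moreover have "snd \<circ> (\<lambda>a. (p a, f a)) = f" by auto
  ultimately show ?thesis using bij_betw_pullback_iff_fibres[of p A B g q f A'] p square by simp
qed

lemma is_jk_graphD:
  assumes "is_jk_graph X"
  shows jk_s_in_arcs: "h \<in> jk_half X \<Longrightarrow> jk_s X h \<in> jk_arcs X"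
    and jk_p_in_verts: "h \<in> jk_half X \<Longrightarrow> jk_p X h \<in> jk_verts X"
    and jk_i_in_arcs: "a \<in> jk_arcs X \<Longrightarrow> jk_i X a \<in> jk_arcs X"
    and jk_i_jk_i: "a \<in> jk_arcs X \<Longrightarrow> jk_i X (jk_i X a) = a"
    and jk_i_neq: "a \<in> jk_arcs X \<Longrightarrow> jk_i X a \<noteq> a"
    and jk_s_eq_iff: "\<lbrakk>h \<in> jk_half X; h' \<in> jk_half X\<rbrakk> \<Longrightarrow> jk_s X h = jk_s X h' \<longleftrightarrow> h = h'"
    and jk_i_eq_iff: "\<lbrakk>a \<in> jk_arcs X; b \<in> jk_arcs X\<rbrakk> \<Longrightarrow> jk_i X a = jk_i X b \<longleftrightarrow> a = b"
  using assms by (auto simp: is_jk_graph_def inj_on_eq_iff) metis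

definition star :: "('a, 'h, 'v) jk_graph \<Rightarrow> 'v \<Rightarrow> 'h set" where
  "star X v = {h \<in> jk_half X. jk_p X h = v}"

lemma etale_homD:
  assumes "f \<in> etale_hom X Y"
  shows etale_arc_in: "a \<in> jk_arcs X \<Longrightarrow> jk_mor_arc f a \<in> jk_arcs Y"
    and etale_half_in: "h \<in> jk_half X \<Longrightarrow> jk_mor_half f h \<in> jk_half Y"
    and etale_vert_in: "v \<in> jk_verts X \<Longrightarrow> jk_mor_vert f v \<in> jk_verts Y"
    and etale_i: "a \<in> jk_arcs X \<Longrightarrow> jk_mor_arc f (jk_i X a) = jk_i Y (jk_mor_arc f a)"
    and etale_s: "h \<in> jk_half X \<Longrightarrow> jk_mor_arc f (jk_s X h) = jk_s Y (jk_mor_half f h)"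
    and etale_p: "h \<in> jk_half X \<Longrightarrow> jk_mor_vert f (jk_p X h) = jk_p Y (jk_mor_half f h)"
  using assms by (auto simp: etale_hom_def)

lemma etale_hom_iff_star:
  assumes "is_jk_graph X"
  shows "f \<in> etale_hom X Y \<longleftrightarrow>
     jk_mor_arc f \<in> jk_arcs X \<rightarrow>\<^sub>E jk_arcs Y \<and>
     jk_mor_half f \<in> jk_half X \<rightarrow>\<^sub>E jk_half Y \<and>
     jk_mor_vert f \<in> jk_verts X \<rightarrow>\<^sub>E jk_verts Y \<and>
     (\<forall>a \<in> jk_arcs X. jk_mor_arc f (jk_i X a) = jk_i Y (jk_mor_arc f a)) \<and>
     (\<forall>h \<in> jk_half X. jk_mor_arc f (jk_s X h) = jk_s Y (jk_mor_half f h)) \<and>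
     (\<forall>h \<in> jk_half X. jk_mor_vert f (jk_p X h) = jk_p Y (jk_mor_half f h)) \<and>
     (\<forall>v \<in> jk_verts X. bij_betw (jk_mor_half f) (star X v) (star Y (jk_mor_vert f v)))"
  using assms
    bij_betw_pullback_iff_fibres[of "jk_p X" "jk_half X" "jk_verts X" "jk_mor_vert f" "jk_p Y"
      "jk_mor_half f" "jk_half Y"]
  by (auto simp: etale_hom_def star_def Pi_iff jk_p_in_verts)

lemma etale_bij_betw_star:
  "\<lbrakk>is_jk_graph X; f \<in> etale_hom X Y; v \<in> jk_verts X\<rbrakk>
    \<Longrightarrow> bij_betw (jk_mor_half f) (star X v) (star Y (jk_mor_vert f v))"
  by (simp add: etale_hom_iff_star)

lemma etale_hom_eqI:
  assumes "f \<in> etale_hom X Y" "g \<in> etale_hom X Y"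
    and "\<And>a. a \<in> jk_arcs X \<Longrightarrow> jk_mor_arc f a = jk_mor_arc g a"
    and "\<And>h. h \<in> jk_half X \<Longrightarrow> jk_mor_half f h = jk_mor_half g h"
    and "\<And>v. v \<in> jk_verts X \<Longrightarrow> jk_mor_vert f v = jk_mor_vert g v"
  shows "f = g"
  using assms unfolding etale_hom_def by (intro jk_mor.equality) (auto intro: PiE_ext)

lemma jk_comp_sel [simp]:
  "jk_mor_arc (jk_comp X Y Z g f) = compose (jk_arcs X) (jk_mor_arc g) (jk_mor_arc f)"
  "jk_mor_half (jk_comp X Y Z g f) = compose (jk_half X) (jk_mor_half g) (jk_mor_half f)"
  "jk_mor_vert (jk_comp X Y Z g f) = compose (jk_verts X) (jk_mor_vert g) (jk_mor_vert f)"
  by (simp_all add: jk_comp_def)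

lemma jk_id_sel [simp]:
  "jk_mor_arc (jk_id X) = (\<lambda>a \<in> jk_arcs X. a)"
  "jk_mor_half (jk_id X) = (\<lambda>h \<in> jk_half X. h)"
  "jk_mor_vert (jk_id X) = (\<lambda>v \<in> jk_verts X. v)"
  by (simp_all add: jk_id_def)

lemma jk_id_etale:
  assumes "is_jk_graph X"
  shows "jk_id X \<in> etale_hom X X"
  using assms unfolding etale_hom_iff_star[OF assms]
  by (auto simp: star_def is_jk_graphD bij_betw_def inj_on_def)

lemma jk_comp_etale:
  assumes X: "is_jk_graph X" and Y: "is_jk_graph Y" and f: "f \<in> etale_hom X Y" and g: "g \<in> etale_hom Y Z"
  shows "jk_comp X Y Z g f \<in> etale_hom X Z"
proof -
  have "bij_betw (jk_mor_half (jk_comp X Y Z g f)) (star X v) (star Z (jk_mor_vert g (jk_mor_vert f v)))"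
    if v: "v \<in> jk_verts X" for v
  proof -
    have "bij_betw (jk_mor_half g \<circ> jk_mor_half f) (star X v) (star Z (jk_mor_vert g (jk_mor_vert f v)))"
      by (rule bij_betw_trans[OF etale_bij_betw_star[OF X f v] etale_bij_betw_star[OF Y g]])
         (rule etale_vert_in[OF f v])
    then show ?thesis
      by (rule bij_betw_cong[THEN iffD1, rotated]) (simp add: star_def compose_def)
  qed
  then show ?thesis
    unfolding etale_hom_iff_star[OF X]
    by (auto simp: compose_def is_jk_graphD[OF X] etale_homD[OF f] etale_homD[OF g])
qed

lemma Gr_sel [simp]: "ob Gr = {X. is_jk_graph X}" "hom Gr = etale_hom" "idm Gr = jk_id" "cmp Gr = jk_comp"
  by (simp_all add: Gr_def)

lemma category_Gr: "category (Gr :: (('a, 'h, 'v) jk_graph, ('a, 'h, 'v) jk_mor) cat)"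
proof
  show "cmp Gr X X Y f (idm Gr X) = f" if "X \<in> ob Gr" "Y \<in> ob Gr" "f \<in> hom Gr X Y"
    for X Y :: "('a, 'h, 'v) jk_graph" and f
    by (rule etale_hom_eqI[of _ X Y]) (use that in \<open>auto simp: jk_comp_etale jk_id_etale compose_def\<close>)
  show "cmp Gr X Y Y (idm Gr Y) f = f" if "X \<in> ob Gr" "Y \<in> ob Gr" "f \<in> hom Gr X Y"
    for X Y :: "('a, 'h, 'v) jk_graph" and f
    by (rule etale_hom_eqI[of _ X Y])
       (use that in \<open>auto simp: jk_comp_etale jk_id_etale compose_def etale_homD\<close>)
  show "cmp Gr W X Z (cmp Gr X Y Z h g) f = cmp Gr W Y Z h (cmp Gr W X Y g f)"
    if "W \<in> ob Gr" "X \<in> ob Gr" "Y \<in> ob Gr" "Z \<in> ob Gr"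
      "f \<in> hom Gr W X" "g \<in> hom Gr X Y" "h \<in> hom Gr Y Z" for W X Y Z :: "('a, 'h, 'v) jk_graph" and f g h
  proof (rule etale_hom_eqI)
    show "cmp Gr W X Z (cmp Gr X Y Z h g) f \<in> etale_hom W Z"
      "cmp Gr W Y Z h (cmp Gr W X Y g f) \<in> etale_hom W Z"
      using that by (auto intro!: jk_comp_etale)
  qed (use that in \<open>auto simp: compose_def etale_homD\<close>)
qed (auto simp: jk_id_etale intro: jk_comp_etale)

lemma etale_bij_betw_half:
  assumes X: "is_jk_graph X" and Y: "is_jk_graph Y" and f: "f \<in> etale_hom X Y"
    and bij: "bij_betw (jk_mor_vert f) (jk_verts X) (jk_verts Y)"
  shows "bij_betw (jk_mor_half f) (jk_half X) (jk_half Y)"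
proof (subst bij_betw_iff_fibres[OF _ _ _ bij])
  show "\<forall>v \<in> jk_verts X. bij_betw (jk_mor_half f) {h \<in> jk_half X. jk_p X h = v}
      {k \<in> jk_half Y. jk_p Y k = jk_mor_vert f v}"
    using etale_bij_betw_star[OF X f] by (simp add: star_def)
qed (auto simp: is_jk_graphD[OF X] is_jk_graphD[OF Y] etale_homD[OF f])

lemma bij_betw_etaleI:
  assumes X: "is_jk_graph X" and Y: "is_jk_graph Y"
    and arc: "jk_mor_arc f \<in> jk_arcs X \<rightarrow>\<^sub>E jk_arcs Y"
    and half: "jk_mor_half f \<in> extensional (jk_half X)" "bij_betw (jk_mor_half f) (jk_half X) (jk_half Y)"
    and vert: "jk_mor_vert f \<in> extensional (jk_verts X)" "bij_betw (jk_mor_vert f) (jk_verts X) (jk_verts Y)"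
    and i: "\<And>a. a \<in> jk_arcs X \<Longrightarrow> jk_mor_arc f (jk_i X a) = jk_i Y (jk_mor_arc f a)"
    and s: "\<And>h. h \<in> jk_half X \<Longrightarrow> jk_mor_arc f (jk_s X h) = jk_s Y (jk_mor_half f h)"
    and p: "\<And>h. h \<in> jk_half X \<Longrightarrow> jk_mor_vert f (jk_p X h) = jk_p Y (jk_mor_half f h)"
  shows "f \<in> etale_hom X Y"
proof -
  have "\<forall>v \<in> jk_verts X. bij_betw (jk_mor_half f) (star X v) (star Y (jk_mor_vert f v))"
    unfolding star_def using half(2)
    by (subst (asm) bij_betw_iff_fibres[OF _ _ _ vert(2)])
       (auto simp: p is_jk_graphD[OF X] is_jk_graphD[OF Y] bij_betw_apply[OF half(2)])
  then show ?thesis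
    unfolding etale_hom_iff_star[OF X]
    using arc half vert by (auto simp: PiE_def i s p bij_betw_apply)
qed

section \<open>Reduced covers are the vertex bijections\<close>

definition no_isolated_edges :: "('a, 'h, 'v) jk_graph \<Rightarrow> bool" where
  "no_isolated_edges X \<longleftrightarrow> (\<nexists>e. isolated_edge X e)"

lemma arc_cases:
  assumes "is_jk_graph X" "no_isolated_edges X" "a \<in> jk_arcs X"
  obtains (half) h where "h \<in> jk_half X" "a = jk_s X h"
    | (opposite) h where "h \<in> jk_half X" "a = jk_i X (jk_s X h)" "a \<notin> jk_s X ` jk_half X"
proof (cases "a \<in> jk_s X ` jk_half X")
  case True
  then show ?thesis using half by blast
next
  case False
  moreover have "{a, jk_i X a} \<inter> jk_s X ` jk_half X \<noteq> {}"
    using assms(2,3) by (auto simp: no_isolated_edges_def isolated_edge_def jk_edges_def)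
  ultimately obtain h where "h \<in> jk_half X" "jk_i X a = jk_s X h" by auto
  moreover from this have "a = jk_i X (jk_s X h)" using jk_i_jk_i[OF assms(1,3)] by simp
  ultimately show ?thesis using opposite False by blast
qed

lemma etale_hom_half_vert_eqI:
  assumes X: "is_jk_graph X" "no_isolated_edges X" and f: "f \<in> etale_hom X Y" and g: "g \<in> etale_hom X Y"
    and half: "\<And>h. h \<in> jk_half X \<Longrightarrow> jk_mor_half f h = jk_mor_half g h"
    and vert: "\<And>v. v \<in> jk_verts X \<Longrightarrow> jk_mor_vert f v = jk_mor_vert g v"
  shows "f = g"
proof (rule etale_hom_eqI[OF f g _ half vert])
  fix a assume "a \<in> jk_arcs X"
  with X show "jk_mor_arc f a = jk_mor_arc g a"
    by (cases rule: arc_cases)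
       (simp_all add: half is_jk_graphD[OF X(1)] etale_i[OF f] etale_i[OF g] etale_s[OF f] etale_s[OF g])
qed

lemma subgraphD:
  assumes "subgraph Z Y"
  shows subgraph_arcs: "jk_arcs Z \<subseteq> jk_arcs Y"
    and subgraph_verts: "jk_verts Z \<subseteq> jk_verts Y"
    and subgraph_s: "h \<in> jk_half Z \<Longrightarrow> jk_s Z h = jk_s Y h"
    and subgraph_p: "h \<in> jk_half Z \<Longrightarrow> jk_p Z h = jk_p Y h"
    and subgraph_i: "a \<in> jk_arcs Z \<Longrightarrow> jk_i Z a = jk_i Y a"
  using assms by (auto simp: subgraph_def etale_hom_def is_jk_graphD)

definition delete_vertex :: "('a, 'h, 'v) jk_graph \<Rightarrow> 'v \<Rightarrow> ('a, 'h, 'v) jk_graph" where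
  "delete_vertex X w =
     \<lparr>jk_arcs = jk_arcs X, jk_half = jk_half X - star X w, jk_verts = jk_verts X - {w},
      jk_s = restrict (jk_s X) (jk_half X - star X w),
      jk_p = restrict (jk_p X) (jk_half X - star X w), jk_i = jk_i X\<rparr>"

lemma delete_vertex_sel [simp]:
  "jk_arcs (delete_vertex X w) = jk_arcs X"
  "jk_half (delete_vertex X w) = jk_half X - star X w"
  "jk_verts (delete_vertex X w) = jk_verts X - {w}"
  "jk_s (delete_vertex X w) = restrict (jk_s X) (jk_half X - star X w)"
  "jk_p (delete_vertex X w) = restrict (jk_p X) (jk_half X - star X w)"
  "jk_i (delete_vertex X w) = jk_i X"
  by (simp_all add: delete_vertex_def)

lemma jk_edges_delete_vertex [simp]: "jk_edges (delete_vertex X w) = jk_edges X"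
  by (simp add: jk_edges_def)

lemma subgraph_delete_vertex:
  assumes X: "is_jk_graph X"
  shows "subgraph (delete_vertex X w) X"
proof -
  have Z: "is_jk_graph (delete_vertex X w)"
    using X by (auto simp: is_jk_graph_def star_def inj_on_def)
  have "star (delete_vertex X w) v = star X v" if "v \<noteq> w" for v
    using that by (auto simp: star_def)
  then have "jk_id (delete_vertex X w) \<in> etale_hom (delete_vertex X w) X"
    unfolding etale_hom_iff_star[OF Z]
    using X by (auto simp: is_jk_graphD star_def bij_betw_def inj_on_def)
  with Z show ?thesis by (simp add: subgraph_def)
qed

lemma jk_edge_subset_arcs: "\<lbrakk>is_jk_graph X; e \<in> jk_edges X\<rbrakk> \<Longrightarrow> e \<subseteq> jk_arcs X"
  by (auto simp: jk_edges_def is_jk_graphD)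

lemma image_arc_comp_id:
  "\<lbrakk>is_jk_graph Z; e \<in> jk_edges Z\<rbrakk> \<Longrightarrow> jk_mor_arc (jk_comp Z Y X f (jk_id Z)) ` e = jk_mor_arc f ` e"
  by (intro image_cong refl) (auto simp: compose_def dest: jk_edge_subset_arcs)

lemma covering_familyD:
  assumes "covering_family X K D f"
  shows covering_family_graph: "k \<in> K \<Longrightarrow> is_jk_graph (D k)"
    and covering_family_etale: "k \<in> K \<Longrightarrow> f k \<in> etale_hom (D k) X"
    and covering_family_verts: "(\<Union>k \<in> K. jk_mor_vert (f k) ` jk_verts (D k)) = jk_verts X"
  using assms by (simp_all add: covering_family_def)

lemma covering_family_subgraph:
  fixes X :: "('a, 'h, 'v) jk_graph" and K :: "'k set"
  assumes cov: "covering_family X K D f" and k: "k \<in> K" and sub: "subgraph Z (D k)"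
    and edges: "jk_edges Z = jk_edges (D k)"
    and verts: "jk_mor_vert (f k) ` (jk_verts (D k) - jk_verts Z)
      \<subseteq> jk_mor_vert (f k) ` jk_verts Z \<union> (\<Union>j \<in> K - {k}. jk_mor_vert (f j) ` jk_verts (D j))"
  shows "covering_family X K (D(k := Z)) (f(k := jk_comp Z (D k) X (f k) (jk_id Z)))"
    (is "covering_family X K ?D ?f")
proof -
  have Z: "is_jk_graph Z" "jk_id Z \<in> etale_hom Z (D k)" using sub by (simp_all add: subgraph_def)
  have "is_jk_graph (?D j) \<and> ?f j \<in> etale_hom (?D j) X" if "j \<in> K" for j
    using that k Z by (simp add: covering_familyD[OF cov] jk_comp_etale)
  moreover have "(\<lambda>e. jk_mor_arc (?f j) ` e) ` jk_edges (?D j)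
      = (\<lambda>e. jk_mor_arc (f j) ` e) ` jk_edges (D j)" for j
    using image_arc_comp_id[OF Z(1)] by (cases "j = k") (simp_all add: edges cong: image_cong)
  moreover have "(\<Union>j \<in> K. jk_mor_vert (?f j) ` jk_verts (?D j)) = jk_verts X"
  proof -
    let ?others = "\<Union>j \<in> K - {k}. jk_mor_vert (f j) ` jk_verts (D j)"
    have split_k: "(\<Union>j \<in> K. A j) = A k \<union> (\<Union>j \<in> K - {k}. A j)" for A :: "'k \<Rightarrow> 'v set"
      using k by auto
    have "(\<Union>j \<in> K. jk_mor_vert (?f j) ` jk_verts (?D j)) = jk_mor_vert (f k) ` jk_verts Z \<union> ?others"
      by (subst split_k) (simp add: compose_def)
    also have "\<dots> = jk_mor_vert (f k) ` jk_verts (D k) \<union> ?others"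
      using verts subgraph_verts[OF sub] by blast
    also have "\<dots> = jk_verts X" using covering_family_verts[OF cov] by (simp add: split_k)
    finally show ?thesis .
  qed
  ultimately show ?thesis using cov by (simp add: covering_family_def)
qed

lemma covering_family_delete_vertex:
  assumes cov: "covering_family X K D f"
    and k: "k \<in> K" "w \<in> jk_verts (D k)" and k': "k' \<in> K" "w' \<in> jk_verts (D k')"
    and distinct: "(k, w) \<noteq> (k', w')" and eq: "jk_mor_vert (f k) w = jk_mor_vert (f k') w'"
  defines "Z \<equiv> delete_vertex (D k) w"
  shows "covering_family X K (D(k := Z)) (f(k := jk_comp Z (D k) X (f k) (jk_id Z)))"
proof (rule covering_family_subgraph[OF cov k(1)])
  show "subgraph Z (D k)"
    unfolding Z_def by (rule subgraph_delete_vertex[OF covering_family_graph[OF cov k(1)]])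
  show "jk_edges Z = jk_edges (D k)" by (simp add: Z_def)
  have "jk_verts (D k) - jk_verts Z = {w}" using k(2) by (auto simp: Z_def)
  moreover have "jk_mor_vert (f k') w' \<in>
      jk_mor_vert (f k) ` jk_verts Z \<union> (\<Union>j \<in> K - {k}. jk_mor_vert (f j) ` jk_verts (D j))"
    using k' distinct by (cases "k' = k") (auto simp: Z_def)
  ultimately show "jk_mor_vert (f k) ` (jk_verts (D k) - jk_verts Z)
      \<subseteq> jk_mor_vert (f k) ` jk_verts Z \<union> (\<Union>j \<in> K - {k}. jk_mor_vert (f j) ` jk_verts (D j))"
    by (simp add: eq)
qed

lemma reduced_covering_family_bij_betw_verts:
  assumes red: "reduced_covering_family X K D f"
  shows "bij_betw (\<lambda>(k, v). jk_mor_vert (f k) v) (SIGMA k:K. jk_verts (D k)) (jk_verts X)"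
proof -
  have cov: "covering_family X K D f" using red by (simp add: reduced_covering_family_def)
  have "inj_on (\<lambda>(k, v). jk_mor_vert (f k) v) (SIGMA k:K. jk_verts (D k))"
  proof (rule inj_onI, clarify, rule ccontr)
    fix k w k' w'
    assume k: "k \<in> K" "w \<in> jk_verts (D k)" and k': "k' \<in> K" "w' \<in> jk_verts (D k')"
      and eq: "jk_mor_vert (f k) w = jk_mor_vert (f k') w'" and "\<not> (k = k' \<and> w = w')"
    then have distinct: "(k, w) \<noteq> (k', w')" by simp
    let ?Z = "delete_vertex (D k) w"
    have "subgraph ?Z (D k)"
      by (intro subgraph_delete_vertex covering_family_graph[OF cov k(1)])
    moreover have "?Z \<noteq> D k" using k(2) by (metis DiffD2 delete_vertex_sel(3) singletonI)
    ultimately have "\<not> covering_family X K (D(k := ?Z)) (f(k := jk_comp ?Z (D k) X (f k) (jk_id ?Z)))"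
      using red k(1) by (simp add: reduced_covering_family_def)
    then show False
      using covering_family_delete_vertex[OF cov k k' distinct eq] by contradiction
  qed
  moreover have "(\<lambda>(k, v). jk_mor_vert (f k) v) ` (SIGMA k:K. jk_verts (D k))
      = (\<Union>k \<in> K. jk_mor_vert (f k) ` jk_verts (D k))"
    by force
  ultimately show ?thesis by (simp add: bij_betw_def covering_family_verts[OF cov])
qed

lemma reduced_cover_bij_betw_verts:
  assumes "reduced_cover Y X f"
  shows "bij_betw (jk_mor_vert f) (jk_verts Y) (jk_verts X)"
proof -
  obtain K :: "nat set" and D fam \<iota> where red: "reduced_covering_family X K D fam"
    and sum: "is_sum K D \<iota> Y" and fam: "\<And>k. k \<in> K \<Longrightarrow> jk_comp (D k) Y X f (\<iota> k) = fam k"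
    using assms unfolding reduced_cover_def by blast
  have \<iota>: "bij_betw (\<lambda>(k, v). jk_mor_vert (\<iota> k) v) (SIGMA k:K. jk_verts (D k)) (jk_verts Y)"
    using sum by (simp add: is_sum_def)
  have "bij_betw (jk_mor_vert f \<circ> (\<lambda>(k, v). jk_mor_vert (\<iota> k) v)) (SIGMA k:K. jk_verts (D k)) (jk_verts X)
      \<longleftrightarrow> bij_betw (\<lambda>(k, v). jk_mor_vert (fam k) v) (SIGMA k:K. jk_verts (D k)) (jk_verts X)"
    by (rule bij_betw_cong) (auto simp: fam[symmetric] compose_def)
  then show ?thesis
    using reduced_covering_family_bij_betw_verts[OF red] by (simp add: bij_betw_comp_iff[OF \<iota>])
qed

lemma subgraph_eqI:
  assumes Y: "is_jk_graph Y" "no_isolated_edges Y" and sub: "subgraph Z Y"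
    and verts: "jk_verts Z = jk_verts Y"
  shows "Z = Y"
proof -
  have Z: "is_jk_graph Z" and inc: "jk_id Z \<in> etale_hom Z Y"
    using sub by (auto simp: subgraph_def)
  have "bij_betw (jk_mor_half (jk_id Z)) (jk_half Z) (jk_half Y)"
    by (rule etale_bij_betw_half[OF Z Y(1) inc]) (auto simp: verts bij_betw_def inj_on_def)
  then have same_half: "jk_half Z = jk_half Y" by (auto simp: bij_betw_def)
  have s: "jk_s Z h = jk_s Y h" "jk_s Y h \<in> jk_arcs Z" if "h \<in> jk_half Y" for h
    using that subgraph_s[OF sub, of h] jk_s_in_arcs[OF Z, of h] by (simp_all add: same_half)
  have "a \<in> jk_arcs Z" if "a \<in> jk_arcs Y" for a
    using Y that
  proof (cases rule: arc_cases)
    case (half h)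
    then show ?thesis using s by simp
  next
    case (opposite h)
    then have "a = jk_i Z (jk_s Y h)" using s subgraph_i[OF sub] by simp
    then show ?thesis using jk_i_in_arcs[OF Z] s opposite by simp
  qed
  then have arcs: "jk_arcs Z = jk_arcs Y" using subgraph_arcs[OF sub] by blast
  have "jk_s Z = jk_s Y"
    using Z Y(1) s same_half
    by (auto simp: is_jk_graph_def PiE_def intro: extensionalityI[where A = "jk_half Y"])
  moreover have "jk_p Z = jk_p Y"
    using Z Y(1) subgraph_p[OF sub] same_half
    by (auto simp: is_jk_graph_def PiE_def intro: extensionalityI[where A = "jk_half Y"])
  moreover have "jk_i Z = jk_i Y"
    using Z Y(1) subgraph_i[OF sub] arcs
    by (auto simp: is_jk_graph_def PiE_def intro: extensionalityI[where A = "jk_arcs Y"])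
  ultimately show ?thesis using arcs same_half verts by simp
qed

lemma etale_surj_on_arcs:
  assumes Y: "is_jk_graph Y" and X: "is_jk_graph X" "no_isolated_edges X" and f: "f \<in> etale_hom Y X"
    and surj: "jk_mor_half f ` jk_half Y = jk_half X"
  shows "jk_mor_arc f ` jk_arcs Y = jk_arcs X"
proof (intro equalityI subsetI)
  fix a assume "a \<in> jk_arcs X"
  with X show "a \<in> jk_mor_arc f ` jk_arcs Y"
  proof (cases rule: arc_cases)
    case (half h)
    then obtain h' where "h' \<in> jk_half Y" "h = jk_mor_half f h'" by (auto simp: surj[symmetric])
    then show ?thesis
      using half(2) by (intro image_eqI[of _ _ "jk_s Y h'"]) (simp_all add: etale_s[OF f] jk_s_in_arcs[OF Y])
  next
    case (opposite h)
    then obtain h' where "h' \<in> jk_half Y" "h = jk_mor_half f h'" by (auto simp: surj[symmetric])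
    then show ?thesis
      using opposite(2) by (intro image_eqI[of _ _ "jk_i Y (jk_s Y h')"])
        (simp_all add: etale_i[OF f] etale_s[OF f] is_jk_graphD[OF Y])
  qed
qed (auto simp: etale_arc_in[OF f])

lemma jk_edges_eq_image: "jk_edges X = (\<lambda>a. {a, jk_i X a}) ` jk_arcs X"
  by (auto simp: jk_edges_def)

lemma etale_image_edges:
  assumes f: "f \<in> etale_hom Y X" and surj: "jk_mor_arc f ` jk_arcs Y = jk_arcs X"
  shows "(\<lambda>e. jk_mor_arc f ` e) ` jk_edges Y = jk_edges X"
proof -
  have "(\<lambda>e. jk_mor_arc f ` e) ` jk_edges Y = (\<lambda>a. {jk_mor_arc f a, jk_mor_arc f (jk_i Y a)}) ` jk_arcs Y"
    by (simp add: jk_edges_eq_image image_image)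
  also have "\<dots> = (\<lambda>a. {jk_mor_arc f a, jk_i X (jk_mor_arc f a)}) ` jk_arcs Y"
    by (intro image_cong refl) (simp add: etale_i[OF f])
  also have "\<dots> = (\<lambda>b. {b, jk_i X b}) ` jk_mor_arc f ` jk_arcs Y" by (simp add: image_image)
  also have "\<dots> = jk_edges X" by (simp add: surj jk_edges_eq_image)
  finally show ?thesis .
qed

lemma no_verts_imp_empty:
  assumes X: "is_jk_graph X" "no_isolated_edges X" "jk_verts X = {}"
  shows "jk_half X = {}" "jk_arcs X = {}"
proof -
  show half: "jk_half X = {}" using jk_p_in_verts[OF X(1)] X(3) by auto
  show "jk_arcs X = {}" using X(1,2) half by (auto elim: arc_cases)
qed

lemma reduced_covering_family_empty:
  assumes "is_jk_graph X" "no_isolated_edges X" "jk_verts X = {}"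
  shows "reduced_covering_family X {} D f"
  using assms(3) no_verts_imp_empty[OF assms]
  by (simp add: reduced_covering_family_def covering_family_def jk_edges_def)

lemma is_sum_empty:
  assumes "is_jk_graph Y" "no_isolated_edges Y" "jk_verts Y = {}"
  shows "is_sum {} D \<iota> Y"
  using assms(1,3) no_verts_imp_empty[OF assms] by (simp add: is_sum_def bij_betw_def)

lemma reduced_covering_family_singleton:
  assumes Y: "is_jk_graph Y" "no_isolated_edges Y" and X: "is_jk_graph X" "no_isolated_edges X"
    and f: "f \<in> etale_hom Y X" and bij: "bij_betw (jk_mor_vert f) (jk_verts Y) (jk_verts X)"
    and nonempty: "jk_verts X \<noteq> {}"
  shows "reduced_covering_family X {k} (\<lambda>_. Y) (\<lambda>_. f)"
proof -
  have "jk_mor_half f ` jk_half Y = jk_half X"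
    using etale_bij_betw_half[OF Y(1) X(1) f bij] by (rule bij_betw_imp_surj_on)
  then have "(\<lambda>e. jk_mor_arc f ` e) ` jk_edges Y = jk_edges X"
    by (intro etale_image_edges[OF f] etale_surj_on_arcs[OF Y(1) X f])
  then have "covering_family X {k} (\<lambda>_. Y) (\<lambda>_. f)"
    using f Y bij by (simp add: covering_family_def bij_betw_def)
  moreover have "\<not> covering_family X {} (\<lambda>_. Y) (\<lambda>_. f)"
    using nonempty by (simp add: covering_family_def)
  moreover have "Z = Y" if sub: "subgraph Z Y"
      and cov: "covering_family X {k} ((\<lambda>_. Y)(k := Z)) ((\<lambda>_. f)(k := jk_comp Z Y X f (jk_id Z)))" for Z
  proof (rule subgraph_eqI[OF Y sub])
    have "jk_mor_vert f ` jk_verts Z = jk_verts X"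
      using cov by (auto simp: covering_family_def compose_def)
    then show "jk_verts Z = jk_verts Y"
      using bij subgraph_verts[OF sub] by (metis bij_betw_def inj_on_image_eq_iff subset_refl)
  qed
  ultimately show ?thesis by (auto simp: reduced_covering_family_def)
qed

lemma is_sum_singleton: "is_jk_graph Y \<Longrightarrow> is_sum {k} (\<lambda>_. Y) (\<lambda>_. jk_id Y) Y"
  by (auto simp: is_sum_def jk_id_etale bij_betw_def inj_on_def image_iff)

lemma reduced_coverI:
  fixes K :: "nat set"
  assumes "f \<in> etale_hom Y X" "reduced_covering_family X K D fam" "is_sum K D \<iota> Y"
    and "\<And>k. k \<in> K \<Longrightarrow> jk_comp (D k) Y X f (\<iota> k) = fam k"
  shows "reduced_cover Y X f"
  unfolding reduced_cover_def using assms
  by (intro conjI exI[of _ K] exI[of _ D] exI[of _ fam] exI[of _ \<iota>]) auto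

lemma reduced_cover_iff_bij_betw_verts:
  assumes Y: "is_jk_graph Y" "no_isolated_edges Y" and X: "is_jk_graph X" "no_isolated_edges X"
    and f: "f \<in> etale_hom Y X"
  shows "reduced_cover Y X f \<longleftrightarrow> bij_betw (jk_mor_vert f) (jk_verts Y) (jk_verts X)"
proof
  assume bij: "bij_betw (jk_mor_vert f) (jk_verts Y) (jk_verts X)"
  show "reduced_cover Y X f"
  proof (cases "jk_verts X = {}")
    \<comment> \<open>The empty graph is covered by the empty family, so there \<open>{f}\<close> is not reduced.\<close>
    case True
    then have "jk_verts Y = {}" using bij by (simp add: bij_betw_def)
    then show ?thesis
      using reduced_coverI[OF f reduced_covering_family_empty[OF X True] is_sum_empty[OF Y]] by simp
  next
    case False
    have "jk_comp Y Y X f (jk_id Y) = f"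
      using category.cmp_idm[OF category_Gr, of Y X f] Y X f by simp
    then show ?thesis
      using reduced_coverI[OF f reduced_covering_family_singleton[OF Y X f bij False] is_sum_singleton[OF Y(1)]]
      by simp
  qed
qed (rule reduced_cover_bij_betw_verts)

lemma Gr_rc_sel [simp]:
  "ob Gr_rc = {X. is_jk_graph X \<and> no_isolated_edges X}"
  "idm Gr_rc = jk_id"
  "cmp Gr_rc = jk_comp"
  by (simp_all add: Gr_rc_def subcat_def no_isolated_edges_def)

lemma hom_Gr_rc_iff:
  assumes "X \<in> ob Gr_rc" "Y \<in> ob Gr_rc"
  shows "f \<in> hom Gr_rc X Y \<longleftrightarrow>
    f \<in> etale_hom X Y \<and> bij_betw (jk_mor_vert f) (jk_verts X) (jk_verts Y)"
proof -
  have "f \<in> hom Gr_rc X Y \<longleftrightarrow> f \<in> etale_hom X Y \<and> reduced_cover X Y f"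
    by (simp add: Gr_rc_def subcat_def)
  then show ?thesis
    using assms by (auto simp: reduced_cover_iff_bij_betw_verts)
qed

lemma Gr_rc_hom_eqI:
  assumes "X \<in> ob Gr_rc" "Y \<in> ob Gr_rc" "f \<in> hom Gr_rc X Y" "g \<in> hom Gr_rc X Y"
    and "\<And>h. h \<in> jk_half X \<Longrightarrow> jk_mor_half f h = jk_mor_half g h"
    and "\<And>v. v \<in> jk_verts X \<Longrightarrow> jk_mor_vert f v = jk_mor_vert g v"
  shows "f = g"
  using assms by (intro etale_hom_half_vert_eqI[of X f Y g]) (simp_all add: hom_Gr_rc_iff)

lemma category_Gr_rc: "category (Gr_rc :: (('a, 'h, 'v) jk_graph, ('a, 'h, 'v) jk_mor) cat)"
  unfolding Gr_rc_def no_isolated_edges_def[symmetric]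
proof (rule category_subcat[OF category_Gr])
  fix X :: "('a, 'h, 'v) jk_graph" assume "X \<in> ob Gr" "no_isolated_edges X"
  then show "reduced_cover X X (idm Gr X)"
    by (simp add: reduced_cover_iff_bij_betw_verts jk_id_etale bij_betw_def inj_on_def)
next
  fix X Y Z :: "('a, 'h, 'v) jk_graph" and f g
  assume graphs: "X \<in> ob Gr" "Y \<in> ob Gr" "Z \<in> ob Gr" "no_isolated_edges X" "no_isolated_edges Z"
    and f: "f \<in> hom Gr X Y" "reduced_cover X Y f" and g: "g \<in> hom Gr Y Z" "reduced_cover Y Z g"
  have "bij_betw (jk_mor_vert g \<circ> jk_mor_vert f) (jk_verts X) (jk_verts Z)"
    using f(2) g(2) by (blast intro: bij_betw_trans reduced_cover_bij_betw_verts)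
  then have "bij_betw (jk_mor_vert (jk_comp X Y Z g f)) (jk_verts X) (jk_verts Z)"
    by (simp add: compose_def o_def)
  moreover have "jk_comp X Y Z g f \<in> etale_hom X Z"
    using graphs f(1) g(1) by (simp add: jk_comp_etale)
  ultimately show "reduced_cover X Z (cmp Gr X Y Z g f)"
    using graphs by (simp add: reduced_cover_iff_bij_betw_verts)
qed

definition jk_inverse ::
  "('a, 'h, 'v) jk_graph \<Rightarrow> ('a, 'h, 'v) jk_graph \<Rightarrow> ('a, 'h, 'v) jk_mor \<Rightarrow> ('a, 'h, 'v) jk_mor" where
  "jk_inverse X Y f =
     \<lparr>jk_mor_arc = restrict (inv_into (jk_arcs X) (jk_mor_arc f)) (jk_arcs Y),
      jk_mor_half = restrict (inv_into (jk_half X) (jk_mor_half f)) (jk_half Y),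
      jk_mor_vert = restrict (inv_into (jk_verts X) (jk_mor_vert f)) (jk_verts Y)\<rparr>"

lemma jk_inverse_sel [simp]:
  "jk_mor_arc (jk_inverse X Y f) = restrict (inv_into (jk_arcs X) (jk_mor_arc f)) (jk_arcs Y)"
  "jk_mor_half (jk_inverse X Y f) = restrict (inv_into (jk_half X) (jk_mor_half f)) (jk_half Y)"
  "jk_mor_vert (jk_inverse X Y f) = restrict (inv_into (jk_verts X) (jk_mor_vert f)) (jk_verts Y)"
  by (simp_all add: jk_inverse_def)

lemma jk_inverse_etale:
  assumes X: "is_jk_graph X" and Y: "is_jk_graph Y" and f: "f \<in> etale_hom X Y"
    and arc: "bij_betw (jk_mor_arc f) (jk_arcs X) (jk_arcs Y)"
    and vert: "bij_betw (jk_mor_vert f) (jk_verts X) (jk_verts Y)"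
  shows "jk_inverse X Y f \<in> etale_hom Y X"
proof (rule bij_betw_etaleI[OF Y X])
  let ?g = "jk_inverse X Y f"
  note half = etale_bij_betw_half[OF X Y f vert]
  note left_inverse = arc[THEN bij_betw_inv_into_left] half[THEN bij_betw_inv_into_left]
    vert[THEN bij_betw_inv_into_left]
  show "jk_mor_arc ?g \<in> jk_arcs Y \<rightarrow>\<^sub>E jk_arcs X"
    using bij_betw_imp_funcset[OF bij_betw_inv_into[OF arc]] by auto
  show "bij_betw (jk_mor_half ?g) (jk_half Y) (jk_half X)"
    using bij_betw_inv_into[OF half] by simp
  show "bij_betw (jk_mor_vert ?g) (jk_verts Y) (jk_verts X)"
    using bij_betw_inv_into[OF vert] by simp
  show "jk_mor_arc ?g (jk_i Y b) = jk_i X (jk_mor_arc ?g b)" if "b \<in> jk_arcs Y" for b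
  proof -
    obtain a where a: "a \<in> jk_arcs X" "b = jk_mor_arc f a"
      using \<open>b \<in> jk_arcs Y\<close> by (auto simp: bij_betw_imp_surj_on[OF arc, symmetric])
    have "jk_mor_arc ?g (jk_mor_arc f (jk_i X a)) = jk_i X (jk_mor_arc ?g (jk_mor_arc f a))"
      using a(1) by (simp add: left_inverse etale_arc_in[OF f] jk_i_in_arcs[OF X])
    then show ?thesis using a by (simp only: etale_i[OF f])
  qed
  fix k assume "k \<in> jk_half Y"
  then obtain h where h: "h \<in> jk_half X" "k = jk_mor_half f h"
    by (auto simp: bij_betw_imp_surj_on[OF half, symmetric])
  have "jk_mor_arc ?g (jk_mor_arc f (jk_s X h)) = jk_s X (jk_mor_half ?g (jk_mor_half f h))"
    "jk_mor_vert ?g (jk_mor_vert f (jk_p X h)) = jk_p X (jk_mor_half ?g (jk_mor_half f h))"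
    using h(1)
    by (simp_all add: left_inverse is_jk_graphD[OF X] etale_arc_in[OF f] etale_half_in[OF f] etale_vert_in[OF f])
  then show "jk_mor_arc ?g (jk_s Y k) = jk_s X (jk_mor_half ?g k)"
    "jk_mor_vert ?g (jk_p Y k) = jk_p X (jk_mor_half ?g k)"
    using h by (simp_all only: etale_s[OF f] etale_p[OF f])
qed simp_all

lemma iso_in_Gr_rcI:
  assumes X: "X \<in> ob Gr_rc" and Y: "Y \<in> ob Gr_rc" and f: "f \<in> hom Gr_rc X Y"
    and arc: "bij_betw (jk_mor_arc f) (jk_arcs X) (jk_arcs Y)"
  shows "iso_in Gr_rc X Y f"
proof -
  let ?g = "jk_inverse X Y f"
  have graphs: "is_jk_graph X" "is_jk_graph Y" using X Y by auto
  have etale: "f \<in> etale_hom X Y" and vert: "bij_betw (jk_mor_vert f) (jk_verts X) (jk_verts Y)"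
    using f by (simp_all add: hom_Gr_rc_iff[OF X Y])
  note half = etale_bij_betw_half[OF graphs etale vert]
  have g_etale: "?g \<in> etale_hom Y X" by (rule jk_inverse_etale[OF graphs etale arc vert])
  moreover have "bij_betw (jk_mor_vert ?g) (jk_verts Y) (jk_verts X)"
    using bij_betw_inv_into[OF vert] by simp
  ultimately have "?g \<in> hom Gr_rc Y X" by (simp add: hom_Gr_rc_iff[OF Y X])
  moreover have "jk_comp X Y X ?g f = jk_id X"
    by (rule etale_hom_eqI[of _ X X])
       (auto simp: jk_comp_etale[OF graphs etale g_etale] jk_id_etale[OF graphs(1)] compose_def etale_homD[OF etale]
         bij_betw_inv_into_left[OF arc] bij_betw_inv_into_left[OF half] bij_betw_inv_into_left[OF vert])
  moreover have "jk_comp Y X Y f ?g = jk_id Y"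
    by (rule etale_hom_eqI[of _ Y Y])
       (auto simp: jk_comp_etale[OF graphs(2,1) g_etale etale] jk_id_etale[OF graphs(2)] compose_def
         bij_betw_inv_into_right[OF arc] bij_betw_inv_into_right[OF half] bij_betw_inv_into_right[OF vert])
  ultimately show ?thesis using f by (auto simp: iso_in_def)
qed

section \<open>Graftings\<close>

lemma is_bm_graphD:
  assumes "is_bm_graph \<tau>"
  shows bm_bdry_in_verts: "f \<in> bm_flags \<tau> \<Longrightarrow> bm_bdry \<tau> f \<in> bm_verts \<tau>"
    and bm_inv_in_flags: "f \<in> bm_flags \<tau> \<Longrightarrow> bm_inv \<tau> f \<in> bm_flags \<tau>"
    and bm_inv_bm_inv: "f \<in> bm_flags \<tau> \<Longrightarrow> bm_inv \<tau> (bm_inv \<tau> f) = f"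
  using assms by (auto simp: is_bm_graph_def)

lemma doubleton_in_bm_edges_iff:
  "is_bm_graph \<tau> \<Longrightarrow>
    {f, f'} \<in> bm_edges \<tau> \<longleftrightarrow> f \<in> bm_flags \<tau> \<and> bm_inv \<tau> f \<noteq> f \<and> f' = bm_inv \<tau> f"
  by (auto simp: bm_edges_def doubleton_eq_iff is_bm_graphD)

lemma bm_edges_eq_image:
  "bm_edges \<tau> = (\<lambda>f. {f, bm_inv \<tau> f}) ` (bm_flags \<tau> - bm_tails \<tau>)"
  by (auto simp: bm_edges_def bm_tails_def)

lemma inj_on_image_bm_edges_iff:
  assumes \<tau>: "is_bm_graph \<tau>" and \<sigma>: "is_bm_graph \<sigma>"
    and g: "inj_on g (bm_flags \<tau>)" "g ` bm_flags \<tau> \<subseteq> bm_flags \<sigma>"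
  shows "(\<forall>e \<in> bm_edges \<tau>. g ` e \<in> bm_edges \<sigma>) \<longleftrightarrow>
    (\<forall>f \<in> bm_flags \<tau> - bm_tails \<tau>. g (bm_inv \<tau> f) = bm_inv \<sigma> (g f))"
proof -
  have "g (bm_inv \<tau> f) \<noteq> g f" if "f \<in> bm_flags \<tau> - bm_tails \<tau>" for f
    using that g(1) bm_inv_in_flags[OF \<tau>] by (auto simp: bm_tails_def inj_on_eq_iff)
  then have "{g f, g (bm_inv \<tau> f)} \<in> bm_edges \<sigma> \<longleftrightarrow> g (bm_inv \<tau> f) = bm_inv \<sigma> (g f)"
    if "f \<in> bm_flags \<tau> - bm_tails \<tau>" for f
    using that g(2) by (auto simp: doubleton_in_bm_edges_iff[OF \<sigma>])
  then show ?thesis by (simp add: bm_edges_eq_image)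
qed

lemma BM_gr_sel [simp]:
  "ob BM_gr = {\<tau>. is_bm_graph \<tau>}"
  "idm BM_gr = bm_id"
  "cmp BM_gr = bm_comp"
  by (simp_all add: BM_gr_def subcat_def BM_def)

definition pushforward_flag :: "('f, 'v) bm_graph \<Rightarrow> ('f, 'v) bm_mor \<Rightarrow> 'f \<Rightarrow> 'f" where
  "pushforward_flag \<sigma> h = inv_into (bm_flags \<sigma>) (bm_mor_flag h)"

lemma ball_bij_betw_inv_into:
  assumes "bij_betw f B A"
  shows "(\<forall>b \<in> B. P (f b) b) \<longleftrightarrow> (\<forall>a \<in> A. P a (inv_into B f a))"
  using assms bij_betw_inv_into_left[OF assms] by (auto simp: bij_betw_def)

lemma bm_hom_iff_if_bij_betw_flags:
  assumes \<tau>: "is_bm_graph \<tau>" and \<sigma>: "is_bm_graph \<sigma>"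
    and bij: "bij_betw (bm_mor_flag h) (bm_flags \<sigma>) (bm_flags \<tau>)"
  shows "h \<in> bm_hom \<tau> \<sigma> \<longleftrightarrow>
     bm_mor_flag h \<in> extensional (bm_flags \<sigma>) \<and> bm_mor_vert h \<in> bm_verts \<tau> \<rightarrow>\<^sub>E bm_verts \<sigma> \<and>
     bm_mor_inv h = (\<lambda>_. undefined) \<and> bm_mor_vert h ` bm_verts \<tau> = bm_verts \<sigma> \<and>
     (\<forall>f \<in> bm_flags \<tau>. bm_mor_vert h (bm_bdry \<tau> f) = bm_bdry \<sigma> (pushforward_flag \<sigma> h f)) \<and>
     (\<forall>f \<in> bm_flags \<tau> - bm_tails \<tau>. pushforward_flag \<sigma> h (bm_inv \<tau> f) = bm_inv \<sigma> (pushforward_flag \<sigma> h f))"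
proof -
  let ?F = "bm_mor_flag h" and ?g = "pushforward_flag \<sigma> h"
  have g: "bij_betw ?g (bm_flags \<tau>) (bm_flags \<sigma>)"
    unfolding pushforward_flag_def using bij by (rule bij_betw_inv_into)
  have img: "?F ` bm_flags \<sigma> = bm_flags \<tau>" and inj: "inj_on ?F (bm_flags \<sigma>)"
    and lost: "bm_lost_flags \<tau> \<sigma> h = {}"
    using bij by (auto simp: bm_lost_flags_def bij_betw_def)
  have flag: "?F \<in> bm_flags \<sigma> \<rightarrow>\<^sub>E bm_flags \<tau> \<longleftrightarrow> ?F \<in> extensional (bm_flags \<sigma>)"
    using img by (auto simp: PiE_def)
  have inv: "bm_inv \<tau> ` bm_flags \<tau> \<subseteq> bm_flags \<tau>" using bm_inv_in_flags[OF \<tau>] by blast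
  have bdry: "(\<forall>f \<in> bm_flags \<sigma>. bm_mor_vert h (bm_bdry \<tau> (?F f)) = bm_bdry \<sigma> f) \<longleftrightarrow>
      (\<forall>f \<in> bm_flags \<tau>. bm_mor_vert h (bm_bdry \<tau> f) = bm_bdry \<sigma> (?g f))"
    unfolding pushforward_flag_def by (rule ball_bij_betw_inv_into[OF bij])
  have "e \<subseteq> bm_flags \<tau>" if "e \<in> bm_edges \<tau>" for e
    using that bm_inv_in_flags[OF \<tau>] by (auto simp: bm_edges_def)
  then have "(\<forall>e \<in> bm_edges \<tau>. e \<subseteq> bm_flags \<tau> \<longrightarrow> ?g ` e \<in> bm_edges \<sigma>) \<longleftrightarrow>
      (\<forall>e \<in> bm_edges \<tau>. ?g ` e \<in> bm_edges \<sigma>)"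
    by simp
  also have "\<dots> \<longleftrightarrow> (\<forall>f \<in> bm_flags \<tau> - bm_tails \<tau>. ?g (bm_inv \<tau> f) = bm_inv \<sigma> (?g f))"
    using g by (intro inj_on_image_bm_edges_iff[OF \<tau> \<sigma>]) (simp_all add: bij_betw_def)
  finally have edges: "(\<forall>e \<in> bm_edges \<tau>. e \<subseteq> bm_flags \<tau> \<longrightarrow> ?g ` e \<in> bm_edges \<sigma>) \<longleftrightarrow> \<dots>" .
  show ?thesis
    unfolding bm_hom_def mem_Collect_eq img lost flag bdry pushforward_flag_def[symmetric] edges
    using inj inv by simp
qed

lemma hom_BM_gr_iff:
  assumes "\<tau> \<in> ob BM_gr" "\<sigma> \<in> ob BM_gr"
  shows "h \<in> hom BM_gr \<tau> \<sigma> \<longleftrightarrow>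
     bm_mor_flag h \<in> extensional (bm_flags \<sigma>) \<and> bm_mor_vert h \<in> extensional (bm_verts \<tau>) \<and>
     bm_mor_inv h = (\<lambda>_. undefined) \<and>
     bij_betw (bm_mor_flag h) (bm_flags \<sigma>) (bm_flags \<tau>) \<and>
     bij_betw (bm_mor_vert h) (bm_verts \<tau>) (bm_verts \<sigma>) \<and>
     (\<forall>f \<in> bm_flags \<tau>. bm_mor_vert h (bm_bdry \<tau> f) = bm_bdry \<sigma> (pushforward_flag \<sigma> h f)) \<and>
     (\<forall>f \<in> bm_flags \<tau> - bm_tails \<tau>. pushforward_flag \<sigma> h (bm_inv \<tau> f) = bm_inv \<sigma> (pushforward_flag \<sigma> h f))"
proof -
  have "h \<in> hom BM_gr \<tau> \<sigma> \<longleftrightarrow> h \<in> bm_hom \<tau> \<sigma> \<and> is_grafting \<tau> \<sigma> h"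
    by (simp add: BM_gr_def subcat_def BM_def)
  then show ?thesis
    using assms
    by (auto simp: is_grafting_def bm_hom_iff_if_bij_betw_flags PiE_def bij_betw_apply bij_betw_imp_surj_on)
qed

lemma hom_BM_grD:
  assumes ob: "\<tau> \<in> ob BM_gr" "\<sigma> \<in> ob BM_gr" and h: "h \<in> hom BM_gr \<tau> \<sigma>"
  shows bij_betw_flag: "bij_betw (bm_mor_flag h) (bm_flags \<sigma>) (bm_flags \<tau>)"
    and bij_betw_vert: "bij_betw (bm_mor_vert h) (bm_verts \<tau>) (bm_verts \<sigma>)"
    and bij_betw_pushforward_flag: "bij_betw (pushforward_flag \<sigma> h) (bm_flags \<tau>) (bm_flags \<sigma>)"
    and pushforward_flag_in: "f \<in> bm_flags \<tau> \<Longrightarrow> pushforward_flag \<sigma> h f \<in> bm_flags \<sigma>"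
    and flag_pushforward_flag: "f \<in> bm_flags \<tau> \<Longrightarrow> bm_mor_flag h (pushforward_flag \<sigma> h f) = f"
    and pushforward_flag_flag: "f' \<in> bm_flags \<sigma> \<Longrightarrow> pushforward_flag \<sigma> h (bm_mor_flag h f') = f'"
    and grafting_bdry: "f \<in> bm_flags \<tau> \<Longrightarrow>
      bm_mor_vert h (bm_bdry \<tau> f) = bm_bdry \<sigma> (pushforward_flag \<sigma> h f)"
    and grafting_inv: "f \<in> bm_flags \<tau> - bm_tails \<tau> \<Longrightarrow>
      pushforward_flag \<sigma> h (bm_inv \<tau> f) = bm_inv \<sigma> (pushforward_flag \<sigma> h f)"
proof -
  show bij: "bij_betw (bm_mor_flag h) (bm_flags \<sigma>) (bm_flags \<tau>)"
    using h by (simp add: hom_BM_gr_iff[OF ob])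
  show push: "bij_betw (pushforward_flag \<sigma> h) (bm_flags \<tau>) (bm_flags \<sigma>)"
    unfolding pushforward_flag_def using bij by (rule bij_betw_inv_into)
  show "f \<in> bm_flags \<tau> \<Longrightarrow> pushforward_flag \<sigma> h f \<in> bm_flags \<sigma>" by (rule bij_betw_apply[OF push])
  show "f \<in> bm_flags \<tau> \<Longrightarrow> bm_mor_flag h (pushforward_flag \<sigma> h f) = f"
    by (simp add: pushforward_flag_def bij_betw_inv_into_right[OF bij])
  show "f' \<in> bm_flags \<sigma> \<Longrightarrow> pushforward_flag \<sigma> h (bm_mor_flag h f') = f'"
    by (simp add: pushforward_flag_def bij_betw_inv_into_left[OF bij])
qed (use h in \<open>simp_all add: hom_BM_gr_iff[OF ob]\<close>)

lemma pushforward_flag_not_tail: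
  assumes ob: "\<tau> \<in> ob BM_gr" "\<sigma> \<in> ob BM_gr" and h: "h \<in> hom BM_gr \<tau> \<sigma>"
    and f: "f \<in> bm_flags \<tau> - bm_tails \<tau>"
  shows "pushforward_flag \<sigma> h f \<in> bm_flags \<sigma> - bm_tails \<sigma>"
proof -
  have "bm_inv \<tau> f \<in> bm_flags \<tau>" using ob(1) f by (simp add: bm_inv_in_flags)
  then have "pushforward_flag \<sigma> h (bm_inv \<tau> f) \<noteq> pushforward_flag \<sigma> h f"
    using f bij_betw_imp_inj_on[OF bij_betw_pushforward_flag[OF ob h]]
    by (auto simp: bm_tails_def inj_on_eq_iff)
  then show ?thesis
    using f pushforward_flag_in[OF ob h] by (simp add: grafting_inv[OF ob h f] bm_tails_def)
qed

lemma BM_gr_hom_eqI: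
  assumes "\<tau> \<in> ob BM_gr" "\<sigma> \<in> ob BM_gr" "h \<in> hom BM_gr \<tau> \<sigma>" "k \<in> hom BM_gr \<tau> \<sigma>"
    and "\<And>f. f \<in> bm_flags \<sigma> \<Longrightarrow> bm_mor_flag h f = bm_mor_flag k f"
    and "\<And>v. v \<in> bm_verts \<tau> \<Longrightarrow> bm_mor_vert h v = bm_mor_vert k v"
  shows "h = k"
proof -
  have "bm_mor_flag h = bm_mor_flag k" "bm_mor_vert h = bm_mor_vert k" "bm_mor_inv h = bm_mor_inv k"
    using assms(3-6) unfolding hom_BM_gr_iff[OF assms(1,2)]
    by (meson extensionalityI, meson extensionalityI, simp)
  then show ?thesis by simp
qed

lemma bm_comp_sel [simp]:
  "bm_mor_flag (bm_comp \<tau> \<sigma> \<rho> k h) = compose (bm_flags \<rho>) (bm_mor_flag h) (bm_mor_flag k)"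
  "bm_mor_vert (bm_comp \<tau> \<sigma> \<rho> k h) = compose (bm_verts \<tau>) (bm_mor_vert k) (bm_mor_vert h)"
  by (simp_all add: bm_comp_def)

lemma bm_id_sel [simp]:
  "bm_mor_flag (bm_id \<tau>) = (\<lambda>f \<in> bm_flags \<tau>. f)"
  "bm_mor_vert (bm_id \<tau>) = (\<lambda>v \<in> bm_verts \<tau>. v)"
  "bm_mor_inv (bm_id \<tau>) = (\<lambda>_. undefined)"
  by (simp_all add: bm_id_def)

lemma pushforward_flag_bm_id: "f \<in> bm_flags \<tau> \<Longrightarrow> pushforward_flag \<tau> (bm_id \<tau>) f = f"
  by (auto simp: pushforward_flag_def inj_on_def intro: inv_into_f_eq)

lemma bij_betw_flag_bm_comp:
  assumes "\<tau> \<in> ob BM_gr" "\<sigma> \<in> ob BM_gr" "\<rho> \<in> ob BM_gr"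
    and h: "h \<in> hom BM_gr \<tau> \<sigma>" and k: "k \<in> hom BM_gr \<sigma> \<rho>"
  shows "bij_betw (bm_mor_flag (bm_comp \<tau> \<sigma> \<rho> k h)) (bm_flags \<rho>) (bm_flags \<tau>)"
  using bij_betw_trans[OF bij_betw_flag[OF assms(2,3) k] bij_betw_flag[OF assms(1,2) h]]
  by (simp add: compose_def o_def)

lemma pushforward_flag_bm_comp:
  assumes ob: "\<tau> \<in> ob BM_gr" "\<sigma> \<in> ob BM_gr" "\<rho> \<in> ob BM_gr"
    and h: "h \<in> hom BM_gr \<tau> \<sigma>" and k: "k \<in> hom BM_gr \<sigma> \<rho>" and f: "f \<in> bm_flags \<tau>"
  shows "pushforward_flag \<rho> (bm_comp \<tau> \<sigma> \<rho> k h) f = pushforward_flag \<rho> k (pushforward_flag \<sigma> h f)"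
proof -
  note h_facts = hom_BM_grD[OF ob(1,2) h] and k_facts = hom_BM_grD[OF ob(2,3) k]
  show ?thesis
    unfolding pushforward_flag_def[of \<rho> "bm_comp \<tau> \<sigma> \<rho> k h"]
    using bij_betw_flag_bm_comp[OF ob h k] f
    by (intro inv_into_f_eq) (simp_all add: bij_betw_def compose_def h_facts k_facts)
qed

lemma bm_id_in_BM_gr: "\<tau> \<in> ob BM_gr \<Longrightarrow> bm_id \<tau> \<in> hom BM_gr \<tau> \<tau>"
  by (simp add: hom_BM_gr_iff pushforward_flag_bm_id is_bm_graphD bij_betw_def inj_on_def)

lemma bm_comp_in_BM_gr:
  assumes ob: "\<tau> \<in> ob BM_gr" "\<sigma> \<in> ob BM_gr" "\<rho> \<in> ob BM_gr"
    and h: "h \<in> hom BM_gr \<tau> \<sigma>" and k: "k \<in> hom BM_gr \<sigma> \<rho>"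
  shows "bm_comp \<tau> \<sigma> \<rho> k h \<in> hom BM_gr \<tau> \<rho>"
proof -
  note h_facts = hom_BM_grD[OF ob(1,2) h] and k_facts = hom_BM_grD[OF ob(2,3) k]
  have \<tau>: "is_bm_graph \<tau>" using ob by simp
  have "bm_mor_flag h ` bm_mor_flag k ` bm_flags \<rho> = bm_flags \<tau>"
    by (simp add: bij_betw_imp_surj_on[OF bij_betw_flag[OF ob(1,2) h]]
        bij_betw_imp_surj_on[OF bij_betw_flag[OF ob(2,3) k]])
  then have "bm_mor_inv (bm_comp \<tau> \<sigma> \<rho> k h) = (\<lambda>_. undefined)"
    by (auto simp: bm_comp_def)
  moreover have "bij_betw (bm_mor_vert (bm_comp \<tau> \<sigma> \<rho> k h)) (bm_verts \<tau>) (bm_verts \<rho>)"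
    using bij_betw_trans[OF bij_betw_vert[OF ob(1,2) h] bij_betw_vert[OF ob(2,3) k]]
    by (simp add: compose_def o_def)
  moreover have "pushforward_flag \<rho> k (pushforward_flag \<sigma> h (bm_inv \<tau> f))
      = bm_inv \<rho> (pushforward_flag \<rho> k (pushforward_flag \<sigma> h f))"
    if "f \<in> bm_flags \<tau> - bm_tails \<tau>" for f
    using that pushforward_flag_not_tail[OF ob(1,2) h that]
    by (simp add: grafting_inv[OF ob(1,2) h] grafting_inv[OF ob(2,3) k])
  ultimately show ?thesis
    unfolding hom_BM_gr_iff[OF ob(1,3)]
    using bij_betw_flag_bm_comp[OF ob h k]
    by (simp add: pushforward_flag_bm_comp[OF ob h k] is_bm_graphD[OF \<tau>] h_facts k_facts compose_eq)
qed

lemma category_BM_gr: "category (BM_gr :: (('f, 'v) bm_graph, ('f, 'v) bm_mor) cat)"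
proof
  show "cmp BM_gr \<tau> \<tau> \<sigma> h (idm BM_gr \<tau>) = h"
    if "\<tau> \<in> ob BM_gr" "\<sigma> \<in> ob BM_gr" "h \<in> hom BM_gr \<tau> \<sigma>" for \<tau> \<sigma> :: "('f, 'v) bm_graph" and h
    by (rule BM_gr_hom_eqI[of \<tau> \<sigma>])
       (use that bm_comp_in_BM_gr[OF that(1,1,2) bm_id_in_BM_gr[OF that(1)]] in
         \<open>simp_all add: compose_eq bij_betw_apply[OF bij_betw_flag]\<close>)
  show "cmp BM_gr \<tau> \<sigma> \<sigma> (idm BM_gr \<sigma>) h = h"
    if "\<tau> \<in> ob BM_gr" "\<sigma> \<in> ob BM_gr" "h \<in> hom BM_gr \<tau> \<sigma>" for \<tau> \<sigma> :: "('f, 'v) bm_graph" and h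
    by (rule BM_gr_hom_eqI[of \<tau> \<sigma>])
       (use that bm_comp_in_BM_gr[OF that(1,2,2) _ bm_id_in_BM_gr[OF that(2)]] in
         \<open>simp_all add: compose_eq bij_betw_apply[OF bij_betw_vert]\<close>)
  show "cmp BM_gr \<tau> \<sigma> \<pi> (cmp BM_gr \<sigma> \<rho> \<pi> l k) h = cmp BM_gr \<tau> \<rho> \<pi> l (cmp BM_gr \<tau> \<sigma> \<rho> k h)"
    if ob: "\<tau> \<in> ob BM_gr" "\<sigma> \<in> ob BM_gr" "\<rho> \<in> ob BM_gr" "\<pi> \<in> ob BM_gr"
      and hkl: "h \<in> hom BM_gr \<tau> \<sigma>" "k \<in> hom BM_gr \<sigma> \<rho>" "l \<in> hom BM_gr \<rho> \<pi>"
    for \<tau> \<sigma> \<rho> \<pi> :: "('f, 'v) bm_graph" and h k l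
  proof (rule BM_gr_hom_eqI[OF ob(1,4)])
    show "cmp BM_gr \<tau> \<sigma> \<pi> (cmp BM_gr \<sigma> \<rho> \<pi> l k) h \<in> hom BM_gr \<tau> \<pi>"
      using bm_comp_in_BM_gr[OF ob(1,2,4) hkl(1) bm_comp_in_BM_gr[OF ob(2,3,4) hkl(2,3)]] by simp
    show "cmp BM_gr \<tau> \<rho> \<pi> l (cmp BM_gr \<tau> \<sigma> \<rho> k h) \<in> hom BM_gr \<tau> \<pi>"
      using bm_comp_in_BM_gr[OF ob(1,3,4) bm_comp_in_BM_gr[OF ob(1,2,3) hkl(1,2)] hkl(3)] by simp
  qed (simp_all add: compose_eq bij_betw_apply[OF bij_betw_flag[OF ob(3,4) hkl(3)]]
        bij_betw_apply[OF bij_betw_vert[OF ob(1,2) hkl(1)]])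
qed (auto intro: bm_id_in_BM_gr[simplified] bm_comp_in_BM_gr[simplified])

section \<open>The functor \<open>\<Phi>\<^sub>1\<close>\<close>

lemma Phi1_ob_sel [simp]:
  "jk_arcs (Phi1_ob \<tau>) = bm_flags \<tau> <+> bm_tails \<tau>"
  "jk_half (Phi1_ob \<tau>) = bm_flags \<tau>"
  "jk_verts (Phi1_ob \<tau>) = bm_verts \<tau>"
  "jk_s (Phi1_ob \<tau>) = (\<lambda>f \<in> bm_flags \<tau>. Inl f)"
  "jk_p (Phi1_ob \<tau>) = bm_bdry \<tau>"
  by (simp_all add: Phi1_ob_def)

lemma jk_i_Phi1_ob:
  shows jk_i_Phi1_ob_edge: "f \<in> bm_flags \<tau> - bm_tails \<tau> \<Longrightarrow> jk_i (Phi1_ob \<tau>) (Inl f) = Inl (bm_inv \<tau> f)"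
    and jk_i_Phi1_ob_tail: "f \<in> bm_tails \<tau> \<Longrightarrow> jk_i (Phi1_ob \<tau>) (Inl f) = Inr f"
    and jk_i_Phi1_ob_Inr: "f \<in> bm_tails \<tau> \<Longrightarrow> jk_i (Phi1_ob \<tau>) (Inr f) = Inl f"
    and jk_i_Phi1_ob_extensional: "jk_i (Phi1_ob \<tau>) \<in> extensional (bm_flags \<tau> <+> bm_tails \<tau>)"
  by (auto simp: Phi1_ob_def bm_tails_def)

lemma Phi1_arc_cases:
  assumes "a \<in> bm_flags \<tau> <+> bm_tails \<tau>"
  obtains (edge) f where "f \<in> bm_flags \<tau> - bm_tails \<tau>" "a = Inl f"
    | (tail) f where "f \<in> bm_tails \<tau>" "a = Inl f"
    | (opposite) f where "f \<in> bm_tails \<tau>" "a = Inr f"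
  using assms by blast

lemma Phi1_ob_in_Gr_rc:
  assumes "\<tau> \<in> ob BM_gr"
  shows "Phi1_ob \<tau> \<in> ob Gr_rc"
proof -
  have \<tau>: "is_bm_graph \<tau>" using assms by simp
  have tails: "bm_tails \<tau> \<subseteq> bm_flags \<tau>" by (auto simp: bm_tails_def)
  let ?i = "jk_i (Phi1_ob \<tau>)"
  have inv: "?i a \<in> bm_flags \<tau> <+> bm_tails \<tau> \<and> ?i (?i a) = a \<and> ?i a \<noteq> a"
    if "a \<in> bm_flags \<tau> <+> bm_tails \<tau>" for a
    using that
  proof (cases rule: Phi1_arc_cases)
    case (edge f)
    moreover from this have "bm_inv \<tau> f \<in> bm_flags \<tau> - bm_tails \<tau>"
      by (auto simp: bm_tails_def is_bm_graphD[OF \<tau>])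
    ultimately show ?thesis by (auto simp: jk_i_Phi1_ob is_bm_graphD[OF \<tau>] bm_tails_def)
  qed (use tails in \<open>auto simp: jk_i_Phi1_ob\<close>)
  have "finite (bm_tails \<tau>)" using \<tau> tails by (auto simp: is_bm_graph_def finite_subset)
  then have "is_jk_graph (Phi1_ob \<tau>)"
    using \<tau> inv jk_i_Phi1_ob_extensional[of \<tau>]
    by (auto simp: is_jk_graph_def is_bm_graph_def inj_on_def PiE_def)
  moreover have "no_isolated_edges (Phi1_ob \<tau>)"
    using tails by (fastforce simp: no_isolated_edges_def isolated_edge_def jk_edges_def jk_i_Phi1_ob_Inr)
  ultimately show ?thesis by simp
qed

lemma Phi1_mor_sel [simp]:
  "jk_mor_arc (Phi1_mor \<tau> \<sigma> h) = (\<lambda>a \<in> bm_flags \<tau> <+> bm_tails \<tau>.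
     case a of Inl f \<Rightarrow> Inl (pushforward_flag \<sigma> h f)
       | Inr f \<Rightarrow> jk_i (Phi1_ob \<sigma>) (Inl (pushforward_flag \<sigma> h f)))"
  "jk_mor_half (Phi1_mor \<tau> \<sigma> h) = restrict (pushforward_flag \<sigma> h) (bm_flags \<tau>)"
  "jk_mor_vert (Phi1_mor \<tau> \<sigma> h) = bm_mor_vert h"
  by (simp_all only: Phi1_mor_def Let_def pushforward_flag_def jk_mor.simps)

lemma Phi1_mor_i:
  assumes \<tau>: "\<tau> \<in> ob BM_gr" and \<sigma>: "\<sigma> \<in> ob BM_gr" and h: "h \<in> hom BM_gr \<tau> \<sigma>"
    and a: "a \<in> bm_flags \<tau> <+> bm_tails \<tau>"
  shows "jk_mor_arc (Phi1_mor \<tau> \<sigma> h) (jk_i (Phi1_ob \<tau>) a) = jk_i (Phi1_ob \<sigma>) (jk_mor_arc (Phi1_mor \<tau> \<sigma> h) a)"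
  using a
proof (cases rule: Phi1_arc_cases)
  case (edge f)
  have \<tau>': "is_bm_graph \<tau>" using \<tau> by simp
  have "pushforward_flag \<sigma> h f \<in> bm_flags \<sigma> - bm_tails \<sigma>" by (rule pushforward_flag_not_tail[OF \<tau> \<sigma> h edge(1)])
  then show ?thesis
    using edge by (simp add: jk_i_Phi1_ob grafting_inv[OF \<tau> \<sigma> h] is_bm_graphD[OF \<tau>'] InlI)
next
  case (opposite f)
  then have "f \<in> bm_flags \<tau>" by (simp add: bm_tails_def)
  then have "Inl (pushforward_flag \<sigma> h f) \<in> jk_arcs (Phi1_ob \<sigma>)"
    using pushforward_flag_in[OF \<tau> \<sigma> h] by (simp add: InlI)
  then show ?thesis
    using opposite \<open>f \<in> bm_flags \<tau>\<close> Phi1_ob_in_Gr_rc[OF \<sigma>]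
    by (simp add: jk_i_Phi1_ob jk_i_jk_i InlI InrI)
qed (auto simp: jk_i_Phi1_ob bm_tails_def)

lemma Phi1_mor_in_Gr_rc:
  assumes \<tau>: "\<tau> \<in> ob BM_gr" and \<sigma>: "\<sigma> \<in> ob BM_gr" and h: "h \<in> hom BM_gr \<tau> \<sigma>"
  shows "Phi1_mor \<tau> \<sigma> h \<in> hom Gr_rc (Phi1_ob \<tau>) (Phi1_ob \<sigma>)"
proof -
  note ob = Phi1_ob_in_Gr_rc[OF \<tau>] Phi1_ob_in_Gr_rc[OF \<sigma>]
  have graphs: "is_jk_graph (Phi1_ob \<tau>)" "is_jk_graph (Phi1_ob \<sigma>)" using ob by simp_all
  have tails: "f \<in> bm_flags \<tau>" if "f \<in> bm_tails \<tau>" for f using that by (simp add: bm_tails_def)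
  have "Phi1_mor \<tau> \<sigma> h \<in> etale_hom (Phi1_ob \<tau>) (Phi1_ob \<sigma>)"
  proof (rule bij_betw_etaleI[OF graphs])
    show "jk_mor_arc (Phi1_mor \<tau> \<sigma> h) \<in> jk_arcs (Phi1_ob \<tau>) \<rightarrow>\<^sub>E jk_arcs (Phi1_ob \<sigma>)"
      using jk_i_in_arcs[OF graphs(2)] by (auto simp: hom_BM_grD[OF \<tau> \<sigma> h] tails InlI)
    show "jk_mor_arc (Phi1_mor \<tau> \<sigma> h) (jk_i (Phi1_ob \<tau>) a) = jk_i (Phi1_ob \<sigma>) (jk_mor_arc (Phi1_mor \<tau> \<sigma> h) a)"
      if "a \<in> jk_arcs (Phi1_ob \<tau>)" for a
      using that by (intro Phi1_mor_i[OF \<tau> \<sigma> h]) simp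
  qed (use h in \<open>simp_all add: hom_BM_grD[OF \<tau> \<sigma> h] InlI hom_BM_gr_iff[OF \<tau> \<sigma>]\<close>)
  then show ?thesis using bij_betw_vert[OF \<tau> \<sigma> h] by (simp add: hom_Gr_rc_iff[OF ob])
qed

lemma functor_Phi1:
  "functor_between (BM_gr :: (('f, 'v) bm_graph, ('f, 'v) bm_mor) cat) Gr_rc Phi1_ob Phi1_mor"
proof -
  interpret C: category "BM_gr :: (('f, 'v) bm_graph, ('f, 'v) bm_mor) cat" by (rule category_BM_gr)
  interpret D: category "Gr_rc :: (('f + 'f, 'f, 'v) jk_graph, ('f + 'f, 'f, 'v) jk_mor) cat"
    by (rule category_Gr_rc)
  show ?thesis
  proof
    show "Phi1_mor \<tau> \<tau> (idm BM_gr \<tau>) = idm Gr_rc (Phi1_ob \<tau>)"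
      if \<tau>: "\<tau> \<in> ob BM_gr" for \<tau> :: "('f, 'v) bm_graph"
      by (rule Gr_rc_hom_eqI[OF _ _ Phi1_mor_in_Gr_rc[OF \<tau> \<tau> C.idm_hom[OF \<tau>]] D.idm_hom])
         (use Phi1_ob_in_Gr_rc[OF \<tau>] in \<open>simp_all add: pushforward_flag_bm_id\<close>)
    show "Phi1_mor \<tau> \<rho> (cmp BM_gr \<tau> \<sigma> \<rho> k h)
        = cmp Gr_rc (Phi1_ob \<tau>) (Phi1_ob \<sigma>) (Phi1_ob \<rho>) (Phi1_mor \<sigma> \<rho> k) (Phi1_mor \<tau> \<sigma> h)"
      if ob: "\<tau> \<in> ob BM_gr" "\<sigma> \<in> ob BM_gr" "\<rho> \<in> ob BM_gr"
        and h: "h \<in> hom BM_gr \<tau> \<sigma>" and k: "k \<in> hom BM_gr \<sigma> \<rho>" for \<tau> \<sigma> \<rho> :: "('f, 'v) bm_graph" and h k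
    proof -
      note Phi_ob = ob[THEN Phi1_ob_in_Gr_rc]
      note Phi_h = Phi1_mor_in_Gr_rc[OF ob(1,2) h] and Phi_k = Phi1_mor_in_Gr_rc[OF ob(2,3) k]
      note Phi_kh = Phi1_mor_in_Gr_rc[OF ob(1,3) C.cmp_hom[OF ob h k]]
      show ?thesis
        by (rule Gr_rc_hom_eqI[OF Phi_ob(1,3) Phi_kh D.cmp_hom[OF Phi_ob Phi_h Phi_k]])
           (simp_all add: compose_eq pushforward_flag_bm_comp[OF ob h k] pushforward_flag_in[OF ob(1,2) h])
    qed
  qed (fact Phi1_ob_in_Gr_rc Phi1_mor_in_Gr_rc)+
qed

lemma inj_on_Phi1_mor:
  assumes \<tau>: "\<tau> \<in> ob BM_gr" and \<sigma>: "\<sigma> \<in> ob BM_gr"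
  shows "inj_on (Phi1_mor \<tau> \<sigma>) (hom BM_gr \<tau> \<sigma>)"
proof (rule inj_onI)
  fix h k assume h: "h \<in> hom BM_gr \<tau> \<sigma>" and k: "k \<in> hom BM_gr \<tau> \<sigma>"
    and eq: "Phi1_mor \<tau> \<sigma> h = Phi1_mor \<tau> \<sigma> k"
  have push: "pushforward_flag \<sigma> h f = pushforward_flag \<sigma> k f" if "f \<in> bm_flags \<tau>" for f
    using arg_cong[OF eq, of "\<lambda>m. jk_mor_half m f"] that by simp
  show "h = k"
  proof (rule BM_gr_hom_eqI[OF \<tau> \<sigma> h k])
    fix f assume f: "f \<in> bm_flags \<sigma>"
    then have F: "bm_mor_flag h f \<in> bm_flags \<tau>"
      by (rule bij_betw_apply[OF bij_betw_flag[OF \<tau> \<sigma> h]])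
    have "pushforward_flag \<sigma> k (bm_mor_flag h f) = f"
      using push[OF F] pushforward_flag_flag[OF \<tau> \<sigma> h f] by simp
    then show "bm_mor_flag h f = bm_mor_flag k f"
      using flag_pushforward_flag[OF \<tau> \<sigma> k F] by simp
  next
    show "bm_mor_vert h v = bm_mor_vert k v" for v
      using arg_cong[OF eq, of jk_mor_vert] by simp
  qed
qed

definition grafting_of :: "('f, 'v) bm_graph \<Rightarrow> ('f, 'v) bm_graph \<Rightarrow> ('a, 'f, 'v) jk_mor \<Rightarrow> ('f, 'v) bm_mor" where
  "grafting_of \<tau> \<sigma> k =
     \<lparr>bm_mor_flag = restrict (inv_into (bm_flags \<tau>) (jk_mor_half k)) (bm_flags \<sigma>),
      bm_mor_vert = jk_mor_vert k, bm_mor_inv = (\<lambda>_. undefined)\<rparr>"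

lemma grafting_of_sel [simp]:
  "bm_mor_flag (grafting_of \<tau> \<sigma> k) = restrict (inv_into (bm_flags \<tau>) (jk_mor_half k)) (bm_flags \<sigma>)"
  "bm_mor_vert (grafting_of \<tau> \<sigma> k) = jk_mor_vert k"
  "bm_mor_inv (grafting_of \<tau> \<sigma> k) = (\<lambda>_. undefined)"
  by (simp_all add: grafting_of_def)

lemma etale_Phi1_edge:
  assumes \<tau>: "\<tau> \<in> ob BM_gr"
    and k: "k \<in> etale_hom (Phi1_ob \<tau>) (Phi1_ob \<sigma>)" and f: "f \<in> bm_flags \<tau> - bm_tails \<tau>"
  shows "jk_mor_half k (bm_inv \<tau> f) = bm_inv \<sigma> (jk_mor_half k f)"
proof -
  have inv: "bm_inv \<tau> f \<in> bm_flags \<tau>" using f \<tau> by (simp add: is_bm_graphD)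
  have half: "jk_mor_half k g \<in> bm_flags \<sigma>" "jk_mor_arc k (Inl g) = Inl (jk_mor_half k g)"
    if "g \<in> bm_flags \<tau>" for g
    using etale_half_in[OF k, of g] etale_s[OF k, of g] that by simp_all
  have "Inl (jk_mor_half k (bm_inv \<tau> f)) = jk_mor_arc k (jk_i (Phi1_ob \<tau>) (Inl f))"
    using f inv by (simp add: half jk_i_Phi1_ob)
  also have "\<dots> = jk_i (Phi1_ob \<sigma>) (Inl (jk_mor_half k f))"
    using etale_i[OF k, of "Inl f"] f by (simp add: half InlI)
  finally have eq: "Inl (jk_mor_half k (bm_inv \<tau> f)) = jk_i (Phi1_ob \<sigma>) (Inl (jk_mor_half k f))" .
  then have "jk_mor_half k f \<notin> bm_tails \<sigma>" by (auto simp: jk_i_Phi1_ob)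
  then show ?thesis using eq f by (simp add: jk_i_Phi1_ob half)
qed

lemma Phi1_mor_preimage:
  assumes \<tau>: "\<tau> \<in> ob BM_gr" and \<sigma>: "\<sigma> \<in> ob BM_gr"
    and k: "k \<in> hom Gr_rc (Phi1_ob \<tau>) (Phi1_ob \<sigma>)"
  shows grafting_of_in_BM_gr: "grafting_of \<tau> \<sigma> k \<in> hom BM_gr \<tau> \<sigma>"
    and Phi1_mor_grafting_of: "Phi1_mor \<tau> \<sigma> (grafting_of \<tau> \<sigma> k) = k"
proof -
  note ob = Phi1_ob_in_Gr_rc[OF \<tau>] Phi1_ob_in_Gr_rc[OF \<sigma>]
  have graphs: "is_jk_graph (Phi1_ob \<tau>)" "is_jk_graph (Phi1_ob \<sigma>)" using ob by simp_all
  have etale: "k \<in> etale_hom (Phi1_ob \<tau>) (Phi1_ob \<sigma>)"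
    and vert: "bij_betw (jk_mor_vert k) (bm_verts \<tau>) (bm_verts \<sigma>)"
    using k by (simp_all add: hom_Gr_rc_iff[OF ob])
  have half: "bij_betw (jk_mor_half k) (bm_flags \<tau>) (bm_flags \<sigma>)"
    using etale_bij_betw_half[OF graphs etale] vert by simp
  have flag: "bij_betw (bm_mor_flag (grafting_of \<tau> \<sigma> k)) (bm_flags \<sigma>) (bm_flags \<tau>)"
    using bij_betw_inv_into[OF half] by simp
  have push: "pushforward_flag \<sigma> (grafting_of \<tau> \<sigma> k) f = jk_mor_half k f" if "f \<in> bm_flags \<tau>" for f
    unfolding pushforward_flag_def
    using that bij_betw_imp_inj_on[OF flag]
    by (intro inv_into_f_eq) (simp_all add: bij_betw_apply[OF half] bij_betw_inv_into_left[OF half])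
  have \<tau>': "is_bm_graph \<tau>" using \<tau> by simp
  have ext: "jk_mor_vert k \<in> extensional (bm_verts \<tau>)" using etale by (simp add: etale_hom_def PiE_def)
  show hom: "grafting_of \<tau> \<sigma> k \<in> hom BM_gr \<tau> \<sigma>"
    unfolding hom_BM_gr_iff[OF \<tau> \<sigma>]
    using flag vert ext etale_p[OF etale] etale_Phi1_edge[OF \<tau> etale]
    by (simp add: push is_bm_graphD[OF \<tau>'])
  show "Phi1_mor \<tau> \<sigma> (grafting_of \<tau> \<sigma> k) = k"
    by (rule Gr_rc_hom_eqI[OF ob Phi1_mor_in_Gr_rc[OF \<tau> \<sigma> hom] k]) (simp_all add: push)
qed

lemma fully_faithful_Phi1:
  "fully_faithful_functor (BM_gr :: (('f, 'v) bm_graph, ('f, 'v) bm_mor) cat) Gr_rc Phi1_ob Phi1_mor"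
proof (intro fully_faithful_functor.intro functor_Phi1 fully_faithful_functor_axioms.intro)
  fix \<tau> \<sigma> :: "('f, 'v) bm_graph" assume ob: "\<tau> \<in> ob BM_gr" "\<sigma> \<in> ob BM_gr"
  have "Phi1_mor \<tau> \<sigma> ` hom BM_gr \<tau> \<sigma> = hom Gr_rc (Phi1_ob \<tau>) (Phi1_ob \<sigma>)"
    using Phi1_mor_in_Gr_rc[OF ob] Phi1_mor_preimage[OF ob] by (auto intro!: rev_image_eqI)
  then show "bij_betw (Phi1_mor \<tau> \<sigma>) (hom BM_gr \<tau> \<sigma>) (hom Gr_rc (Phi1_ob \<tau>) (Phi1_ob \<sigma>))"
    using inj_on_Phi1_mor[OF ob] by (simp add: bij_betw_def)
qed

definition opposite_half :: "('a, 'h, 'v) jk_graph \<Rightarrow> 'h \<Rightarrow> 'h" where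
  "opposite_half X h =
     (if jk_i X (jk_s X h) \<in> jk_s X ` jk_half X then inv_into (jk_half X) (jk_s X) (jk_i X (jk_s X h)) else h)"

definition half_edge_graph :: "('a, 'h, 'v) jk_graph \<Rightarrow> ('h, 'v) bm_graph" where
  "half_edge_graph X = \<lparr>bm_verts = jk_verts X, bm_flags = jk_half X, bm_bdry = jk_p X,
     bm_inv = restrict (opposite_half X) (jk_half X)\<rparr>"

lemma half_edge_graph_sel [simp]:
  "bm_verts (half_edge_graph X) = jk_verts X"
  "bm_flags (half_edge_graph X) = jk_half X"
  "bm_bdry (half_edge_graph X) = jk_p X"
  "bm_inv (half_edge_graph X) = restrict (opposite_half X) (jk_half X)"
  by (simp_all add: half_edge_graph_def)

lemma opposite_half_eq:
  "\<lbrakk>is_jk_graph X; h' \<in> jk_half X; jk_i X (jk_s X h) = jk_s X h'\<rbrakk> \<Longrightarrow> opposite_half X h = h'"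
  by (auto simp: opposite_half_def is_jk_graph_def)

lemma half_cases:
  assumes X: "is_jk_graph X" and h: "h \<in> jk_half X"
  obtains (tail) "jk_i X (jk_s X h) \<notin> jk_s X ` jk_half X" "opposite_half X h = h"
    | (edge) "opposite_half X h \<in> jk_half X" "jk_i X (jk_s X h) = jk_s X (opposite_half X h)"
        "opposite_half X h \<noteq> h"
proof (cases "jk_i X (jk_s X h) \<in> jk_s X ` jk_half X")
  case True
  then obtain h' where h': "h' \<in> jk_half X" "jk_i X (jk_s X h) = jk_s X h'" by blast
  moreover have "h' \<noteq> h" using h'(2) jk_i_neq[OF X jk_s_in_arcs[OF X h]] by auto
  ultimately show ?thesis using opposite_half_eq[OF X h'] by (intro edge) simp_all
next
  case False
  then show ?thesis by (intro tail) (simp_all add: opposite_half_def)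
qed

lemma opposite_half_opposite_half:
  assumes X: "is_jk_graph X" and h: "h \<in> jk_half X"
  shows "opposite_half X (opposite_half X h) = h"
  using X h
proof (cases rule: half_cases)
  case edge
  then have "jk_i X (jk_s X (opposite_half X h)) = jk_s X h"
    using jk_i_jk_i[OF X jk_s_in_arcs[OF X h]] by simp
  then show ?thesis by (rule opposite_half_eq[OF X h])
qed simp

lemma half_edge_graph_in_BM_gr:
  assumes "is_jk_graph X"
  shows "half_edge_graph X \<in> ob BM_gr"
proof -
  have "opposite_half X h \<in> jk_half X" if "h \<in> jk_half X" for h
    using assms that by (cases rule: half_cases) (simp_all add: that)
  then show ?thesis
    using assms opposite_half_opposite_half[OF assms] by (auto simp: is_bm_graph_def is_jk_graph_def)
qed

lemma in_tails_half_edge_graph_iff: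
  assumes X: "is_jk_graph X"
  shows "h \<in> bm_tails (half_edge_graph X) \<longleftrightarrow>
    h \<in> jk_half X \<and> jk_i X (jk_s X h) \<notin> jk_s X ` jk_half X"
proof (cases "h \<in> jk_half X")
  case True
  from X this show ?thesis
    by (cases rule: half_cases) (auto simp: bm_tails_def True)
qed (simp add: bm_tails_def)

lemma jk_s_opposite_half:
  assumes "is_jk_graph X" "h \<in> jk_half X - bm_tails (half_edge_graph X)"
  shows "jk_s X (opposite_half X h) = jk_i X (jk_s X h)"
proof -
  have "h \<in> jk_half X" using assms(2) by simp
  from assms(1) this show ?thesis
    by (cases rule: half_cases) (use assms(2) in_tails_half_edge_graph_iff[OF assms(1)] in auto)
qed

definition half_edge_graph_iso :: "('h + 'h, 'h, 'v) jk_graph \<Rightarrow> ('h + 'h, 'h, 'v) jk_mor" where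
  "half_edge_graph_iso X =
     \<lparr>jk_mor_arc = (\<lambda>a \<in> jk_half X <+> bm_tails (half_edge_graph X).
        case a of Inl h \<Rightarrow> jk_s X h | Inr h \<Rightarrow> jk_i X (jk_s X h)),
      jk_mor_half = (\<lambda>h \<in> jk_half X. h), jk_mor_vert = (\<lambda>v \<in> jk_verts X. v)\<rparr>"

lemma half_edge_graph_iso_sel [simp]:
  "jk_mor_arc (half_edge_graph_iso X) = (\<lambda>a \<in> jk_half X <+> bm_tails (half_edge_graph X).
     case a of Inl h \<Rightarrow> jk_s X h | Inr h \<Rightarrow> jk_i X (jk_s X h))"
  "jk_mor_half (half_edge_graph_iso X) = (\<lambda>h \<in> jk_half X. h)"
  "jk_mor_vert (half_edge_graph_iso X) = (\<lambda>v \<in> jk_verts X. v)"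
  by (simp_all add: half_edge_graph_iso_def)

lemma half_edge_graph_iso_etale:
  assumes X: "is_jk_graph X"
  shows "half_edge_graph_iso X \<in> etale_hom (Phi1_ob (half_edge_graph X)) X"
proof -
  let ?T = "bm_tails (half_edge_graph X)"
  note tails_iff = in_tails_half_edge_graph_iff[OF X]
  have Y: "is_jk_graph (Phi1_ob (half_edge_graph X))"
    using Phi1_ob_in_Gr_rc[OF half_edge_graph_in_BM_gr[OF X]] by simp
  show ?thesis
  proof (rule bij_betw_etaleI[OF Y X])
    fix a assume "a \<in> jk_arcs (Phi1_ob (half_edge_graph X))"
    then have a: "a \<in> bm_flags (half_edge_graph X) <+> ?T" by simp
    then show "jk_mor_arc (half_edge_graph_iso X) (jk_i (Phi1_ob (half_edge_graph X)) a)
      = jk_i X (jk_mor_arc (half_edge_graph_iso X) a)"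
    proof (cases rule: Phi1_arc_cases)
      case (edge h)
      have "opposite_half X h \<in> jk_half X"
        using edge bm_inv_in_flags[of "half_edge_graph X" h] half_edge_graph_in_BM_gr[OF X] by simp
      then show ?thesis
        using edge jk_s_opposite_half[OF X, of h] by (simp add: jk_i_Phi1_ob InlI)
    next
      case (tail h)
      then show ?thesis by (simp add: jk_i_Phi1_ob tails_iff InlI InrI)
    next
      case (opposite h)
      then show ?thesis by (simp add: jk_i_Phi1_ob tails_iff InlI InrI is_jk_graphD[OF X])
    qed
  qed (auto simp: bij_betw_def inj_on_def is_jk_graphD[OF X] tails_iff)
qed

lemma bij_betw_arc_half_edge_graph_iso:
  assumes X: "is_jk_graph X" "no_isolated_edges X"
  shows "bij_betw (jk_mor_arc (half_edge_graph_iso X)) (jk_arcs (Phi1_ob (half_edge_graph X))) (jk_arcs X)"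
    (is "bij_betw ?c ?A _")
proof (rule bij_betw_imageI)
  note tails_iff = in_tails_half_edge_graph_iff[OF X(1)]
  show "inj_on ?c ?A"
    by (rule inj_onI) (auto simp: tails_iff is_jk_graphD[OF X(1)], metis imageI)
  show "?c ` ?A = jk_arcs X"
  proof (intro equalityI subsetI)
    fix a assume "a \<in> jk_arcs X"
    with X show "a \<in> ?c ` ?A"
    proof (cases rule: arc_cases)
      case (half h)
      then show ?thesis by (intro image_eqI[of _ _ "Inl h"]) auto
    next
      case (opposite h)
      then show ?thesis by (intro image_eqI[of _ _ "Inr h"]) (auto simp: tails_iff)
    qed
  qed (auto simp: tails_iff is_jk_graphD[OF X(1)])
qed

lemma iso_in_half_edge_graph_iso:
  assumes X: "X \<in> ob Gr_rc"
  shows "iso_in Gr_rc (Phi1_ob (half_edge_graph X)) X (half_edge_graph_iso X)"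
proof -
  have graph: "is_jk_graph X" "no_isolated_edges X" using X by simp_all
  have Y: "Phi1_ob (half_edge_graph X) \<in> ob Gr_rc"
    by (intro Phi1_ob_in_Gr_rc half_edge_graph_in_BM_gr graph)
  have "half_edge_graph_iso X \<in> hom Gr_rc (Phi1_ob (half_edge_graph X)) X"
    unfolding hom_Gr_rc_iff[OF Y X] using half_edge_graph_iso_etale[OF graph(1)]
    by (simp add: bij_betw_def inj_on_def)
  then show ?thesis
    by (rule iso_in_Gr_rcI[OF Y X _ bij_betw_arc_half_edge_graph_iso[OF graph]])
qed

theorem proposition3p6:
  shows "equivalence_of_categories
    (BM_gr :: (('f, 'v) bm_graph, ('f, 'v) bm_mor) cat)
    (Gr_rc :: (('f + 'f, 'f, 'v) jk_graph, ('f + 'f, 'f, 'v) jk_mor) cat)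
    Phi1_ob Phi1_mor"
proof (rule fully_faithful_essentially_surjective_equivalence[OF fully_faithful_Phi1])
  fix X :: "('f + 'f, 'f, 'v) jk_graph"
  assume X: "X \<in> ob Gr_rc"
  then have "half_edge_graph X \<in> ob BM_gr" by (intro half_edge_graph_in_BM_gr) simp
  moreover have "iso_in Gr_rc (Phi1_ob (half_edge_graph X)) X (half_edge_graph_iso X)"
    by (rule iso_in_half_edge_graph_iso[OF X])
  ultimately show "\<exists>\<tau> \<in> ob BM_gr. \<exists>e. iso_in Gr_rc (Phi1_ob \<tau>) X e" by blast
qed

end
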